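(* Let $(G,L)$ be a $(G,L)$-pair, let $\alpha,\beta,\gamma$ be multi-indices, $\mathfrak g\in L^\gamma\setminus G/L^\beta$, $\mathfrak h\in L^\beta\setminus G/L^\alpha$, choose representatives $g\in\mathfrak g$, $h\in\mathfrak h$ and put $z_m=g\,\Theta_m^{[\beta]}h\in G$. Then: a) The double coset $\mathfrak z_m=L^\gamma z_mL^\alpha$ is eventually constant (as $m\to\infty$). b) The result $\mathfrak g\circ\mathfrak h:=\lim\mathfrak z_m\in L^\gamma\setminus G/L^\alpha$ does not depend on the choice of representatives $g\in\mathfrak g$, $h\in\mathfrak h$. c) The operation obtained in this way is associative: for all $\alpha,\beta,\gamma,\delta$ and any $\mathfrak f\in L^\delta\setminus G/L^\gamma$, $\mathfrak g\in L^\gamma\setminus G/L^\beta$, $\mathfrak h\in L^\beta\setminus G/L^\alpha$ one has $(\mathfrak f\circ\mathfrak g)\circ\mathfrak h=\mathfrak f\circ(\mathfrak g\circ\mathfrak h)$.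
   Context: Classical groups. A matrix $g$ over $\mathbb R,\mathbb C$ or $\mathbb H$ with rows and columns indexed by a countable basis is finite if $g-1$ has only finitely many nonzero entries. All groups below consist of finite invertible matrices satisfying the usual identities. The irreducible classical groups and their maximal heavy subgroups are: $\mathrm{GL}(\infty,\mathbb R)\supset \mathrm O(\infty)$; $\mathrm{GL}(\infty,\mathbb C)\supset \mathrm U(\infty)$; $\mathrm{GL}(\infty,\mathbb H)\supset\mathrm{Sp}(\infty)$; $\mathrm U(\infty,\infty)\supset \mathrm U(\infty)\times \mathrm U(\infty)$; $\mathrm{Sp}(2\infty,\mathbb R)\supset \mathrm U(\infty)$; $\mathrm{Sp}(2\infty,\mathbb C)\supset\mathrm{Sp}(\infty)$; $\mathrm{Sp}(\infty,\infty)\supset\mathrm{Sp}(\infty)\times\mathrm{Sp}(\infty)$; $\mathrm O(\infty,\infty)\supset\mathrm O(\infty)\times\mathrm O(\infty)$; $\mathrm O(\infty,\mathbb C)\supset\mathrm O(\infty)$; $\mathrm{SO}^*(2\infty)\supset\mathrm U(\infty)$; $\mathrm U(p,\infty)\supset\mathrm U(\infty)$; $\mathrm O(p,\infty)\supset\mathrm O(\infty)$; $\mathrm{Sp}(p,\infty)\supset\mathrm{Sp}(\infty)$ with $0\le p<\infty$ (for $p=0$: the groups $\mathrm U(\infty),\mathrm O(\infty),\mathrm{Sp}(\infty)$ themselves). Here $\mathrm{Sp}(\infty)$ is the quaternionic unitary group. A classical group is a finite product of irreducible ones; its maximal heavy subgroup $K$ is the product of the maximal heavy subgroups of the factors. A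 heavy group is a finite product of groups $\mathrm O(\infty),\mathrm U(\infty),\mathrm{Sp}(\infty)$ (called irreducible heavy groups). Straight homomorphisms. Trivial homomorphisms between irreducible heavy groups are: the identity maps, elementwise complex conjugation of $\mathrm U(\infty)$, and the obvious maps $\mathrm O(\infty)\to\mathrm U(\infty)$, $\mathrm O(\infty)\to\mathrm{Sp}(\infty)$, $\mathrm U(\infty)\to\mathrm{Sp}(\infty)$, $\mathrm U(\infty)\to\mathrm O(2\infty)$, $\mathrm{Sp}(\infty)\to\mathrm O(4\infty)$, $\mathrm{Sp}(\infty)\to\mathrm U(2\infty)$. For $L=L_1\times\dots\times L_p$ heavy and $K$ irreducible heavy, a homomorphism $L\to K$ is straight if it has the block diagonal form $(g_1,\dots,g_p)\mapsto\mathrm{diag}(1_a,\tau_1(g_{m_1}),\dots,\tau_N(g_{m_N}))$ with $\tau_j$ trivial, $0<N<\infty$, $a\in\{0,1,2,\dots,\infty\}$ (not required to be faithful). For $K=K_1\times\dots\times K_q$, a straight homomorphism $L\to K$ is a product of straight homomorphisms $L\to K_i$. A $(G,L)$-pair consists of a classical group $G$ with maximal heavy subgroup $K$ and a heavy group $L$ straightly embedded in $K$. For $L=L_1\times\dots\times L_p$ and a multi-index $\alpha=(\alpha_1,\dots,\alpha_p)\in\mathbb Z_{\ge0}^p$, $L^\alpha=L_1^{\alpha_1}\times\dots\times L_p^{\alpha_p}$, where $L_j^{\alpha_j}$ is the stabilizer in $L_j$ of the first $\alpha_j$ basis vectors of its $\ell_2$. For a multi-index $m$, $\Theta_m^{[\alpha]}=(\Theta_{m_1}^{[\alpha_1]},\dots,\Theta_{m_p}^{[\alpha_p]})\in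 L$, where $$\Theta_{m_j}^{[\alpha_j]}=\begin{pmatrix}1_{\alpha_j}&0&0&0\\0&0&1_{m_j}&0\\0&1_{m_j}&0&0\\0&0&0&1_\infty\end{pmatrix}\in L_j.$$ "Eventually constant" means: there is $m^0$ such that $\mathfrak z_m$ is the same for all $m$ with $m_j\ge m_j^0$ for all $j$. *)

theory Defs
  imports Complex_Main "HOL-Algebra.Coset" "HOL-Algebra.Product_Groups"
begin

section \<open>Quaternions\<close>

datatype quat = Quat (q_re: real) (q_i: real) (q_j: real) (q_k: real)

instantiation quat :: ring_1
begin

definition "0 = Quat 0 0 0 0"
definition "1 = Quat 1 0 0 0"
definition "p + q = Quat (q_re p + q_re q) (q_i p + q_i q) (q_j p + q_j q) (q_k p + q_k q)"
definition "- q = Quat (- q_re q) (- q_i q) (- q_j q) (- q_k q)"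
definition "p - q = Quat (q_re p - q_re q) (q_i p - q_i q) (q_j p - q_j q) (q_k p - q_k q)"
definition "p * q = Quat
  (q_re p * q_re q - q_i p * q_i q - q_j p * q_j q - q_k p * q_k q)
  (q_re p * q_i q + q_i p * q_re q + q_j p * q_k q - q_k p * q_j q)
  (q_re p * q_j q - q_i p * q_k q + q_j p * q_re q + q_k p * q_i q)
  (q_re p * q_k q + q_i p * q_j q - q_j p * q_i q + q_k p * q_re q)"

lemmas quat_defs = zero_quat_def one_quat_def plus_quat_def uminus_quat_def
  minus_quat_def times_quat_def

instance
  by standard (simp_all add: quat_defs quat.expand algebra_simps)

end

definition quat_cnj :: "quat \<Rightarrow> quat"
  where "quat_cnj q = Quat (q_re q) (- q_i q) (- q_j q) (- q_k q)"

text \<open>The fields \<open>\<real>\<close> and \<open>\<complex> = \<real> + \<real>i\<close> are regarded as subfields of the quaternions, so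
  that matrices over all three are matrices of quaternions with entries in \<^term>\<open>scalar_set\<close>.
  Quaternionic conjugation restricts to complex conjugation on \<open>\<complex>\<close> and to the identity
  on \<open>\<real>\<close>.\<close>

datatype scalars = RR | CC | HH

fun scalar_set :: "scalars \<Rightarrow> quat set"
  where
    "scalar_set RR = {q. q_i q = 0 \<and> q_j q = 0 \<and> q_k q = 0}"
  | "scalar_set CC = {q. q_j q = 0 \<and> q_k q = 0}"
  | "scalar_set HH = UNIV"


section \<open>Finite matrices\<close>

type_synonym 'i qmat = "'i \<Rightarrow> 'i \<Rightarrow> quat"

definition mat_one :: "'i qmat"
  where "mat_one a b = (if a = b then 1 else 0)"

text \<open>The sum is finite (hence meaningful) when the rows of \<open>A\<close> are finitely supported; this
  is the case for all matrices multiplied below.\<close>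

definition mat_mult :: "'i qmat \<Rightarrow> 'i qmat \<Rightarrow> 'i qmat"
  where "mat_mult A B a b = (\<Sum>c | A a c \<noteq> 0. A a c * B c b)"

definition transp :: "'i qmat \<Rightarrow> 'i qmat"
  where "transp A a b = A b a"

definition adj :: "'i qmat \<Rightarrow> 'i qmat"
  where "adj A a b = quat_cnj (A b a)"

text \<open>Finite matrices with rows and columns indexed by the basis \<open>I\<close>. They are extended by
  the identity to the whole index type.\<close>

definition finite_matrices :: "'i set \<Rightarrow> scalars \<Rightarrow> 'i qmat monoid"
  where "finite_matrices I F =
    \<lparr>carrier = {A. (\<forall>a b. A a b \<in> scalar_set F) \<and>
                   finite {(a, b). A a b \<noteq> mat_one a b} \<and>
                   {(a, b). A a b \<noteq> mat_one a b} \<subseteq> I \<times> I},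
     monoid.mult = mat_mult, one = mat_one\<rparr>"

definition matrix_group :: "'i set \<Rightarrow> scalars \<Rightarrow> ('i qmat \<Rightarrow> bool) \<Rightarrow> 'i qmat monoid"
  where "matrix_group I F P =
    (units_of (finite_matrices I F))
      \<lparr>carrier := {A \<in> Units (finite_matrices I F). P A}\<rparr>"


section \<open>Heavy groups\<close>

text \<open>\<open>O(\<infinity>)\<close>, \<open>U(\<infinity>)\<close> and \<open>Sp(\<infinity>)\<close> for \<^term>\<open>RR\<close>, \<^term>\<open>CC\<close> and \<^term>\<open>HH\<close>, respectively.\<close>

definition irr_heavy :: "scalars \<Rightarrow> nat qmat monoid"
  where "irr_heavy F = matrix_group UNIV F (\<lambda>A. mat_mult (adj A) A = mat_one)"

definition heavy :: "'a set \<Rightarrow> ('a \<Rightarrow> scalars) \<Rightarrow> ('a \<Rightarrow> nat qmat) monoid"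
  where "heavy I F = product_group I (\<lambda>i. irr_heavy (F i))"

abbreviation heavy_list :: "scalars list \<Rightarrow> (nat \<Rightarrow> nat qmat) monoid"
  where "heavy_list Ls \<equiv> heavy {..<length Ls} (\<lambda>j. Ls ! j)"


section \<open>Irreducible classical groups\<close>

text \<open>
  \<^item> \<open>GL_inf F\<close> is \<open>GL(\<infinity>, F)\<close>;
  \<^item> \<open>U_inf_inf F\<close> is \<open>O(\<infinity>,\<infinity>)\<close>, \<open>U(\<infinity>,\<infinity>)\<close>, \<open>Sp(\<infinity>,\<infinity>)\<close>
    for \<open>F = \<real>, \<complex>, \<H>\<close>;
  \<^item> \<open>U_fin_inf F p\<close> is \<open>O(p,\<infinity>)\<close>, \<open>U(p,\<infinity>)\<close>, \<open>Sp(p,\<infinity>)\<close>;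
  \<^item> \<open>Sp_R\<close> is \<open>Sp(2\<infinity>, \<real>)\<close>, \<open>Sp_C\<close> is \<open>Sp(2\<infinity>, \<complex>)\<close>, \<open>O_C\<close> is \<open>O(\<infinity>, \<complex>)\<close>,
    and \<open>SO_star\<close> is \<open>SO*(2\<infinity>)\<close>, realized by quaternionic matrices preserving a
    skew-Hermitian form.
\<close>

datatype irr_classical =
    GL_inf scalars
  | U_inf_inf scalars
  | U_fin_inf scalars nat
  | Sp_R
  | Sp_C
  | O_C
  | SO_star

fun ground :: "irr_classical \<Rightarrow> scalars"
  where
    "ground (GL_inf F) = F"
  | "ground (U_inf_inf F) = F"
  | "ground (U_fin_inf F p) = F"
  | "ground Sp_R = RR"
  | "ground Sp_C = CC"
  | "ground O_C = CC"
  | "ground SO_star = HH"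

fun basis :: "irr_classical \<Rightarrow> (nat + nat) set"
  where
    "basis (GL_inf F) = range Inr"
  | "basis (U_inf_inf F) = UNIV"
  | "basis (U_fin_inf F p) = Inl ` {..<p} \<union> range Inr"
  | "basis Sp_R = UNIV"
  | "basis Sp_C = UNIV"
  | "basis O_C = range Inr"
  | "basis SO_star = range Inr"

text \<open>The \<open>2 \<times> 2\<close> block matrix with rows and columns split into \<open>Inl\<close> and \<open>Inr\<close>.\<close>

fun blocks :: "nat qmat \<Rightarrow> nat qmat \<Rightarrow> nat qmat \<Rightarrow> nat qmat \<Rightarrow> (nat + nat) qmat"
  where
    "blocks A B C D (Inl a) (Inl b) = A a b"
  | "blocks A B C D (Inl a) (Inr b) = B a b"
  | "blocks A B C D (Inr a) (Inl b) = C a b"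
  | "blocks A B C D (Inr a) (Inr b) = D a b"

abbreviation mat_zero :: "nat qmat"
  where "mat_zero \<equiv> (\<lambda>a b. 0)"

definition hermitian_form :: "(nat + nat) qmat"
  where "hermitian_form = blocks (\<lambda>a b. - mat_one a b) mat_zero mat_zero mat_one"

definition symplectic_form :: "(nat + nat) qmat"
  where "symplectic_form = blocks mat_zero mat_one (\<lambda>a b. - mat_one a b) mat_zero"

definition skew_hermitian_form :: "(nat + nat) qmat"
  where "skew_hermitian_form a b = (if a = b then Quat 0 1 0 0 else 0)"

fun identity :: "irr_classical \<Rightarrow> (nat + nat) qmat \<Rightarrow> bool"
  where
    "identity (GL_inf F) g = True"
  | "identity (U_inf_inf F) g =
      (mat_mult (mat_mult (adj g) hermitian_form) g = hermitian_form)"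
  | "identity (U_fin_inf F p) g =
      (mat_mult (mat_mult (adj g) hermitian_form) g = hermitian_form)"
  | "identity Sp_R g = (mat_mult (mat_mult (transp g) symplectic_form) g = symplectic_form)"
  | "identity Sp_C g = (mat_mult (mat_mult (transp g) symplectic_form) g = symplectic_form)"
  | "identity O_C g = (mat_mult (transp g) g = mat_one)"
  | "identity SO_star g =
      (mat_mult (mat_mult (adj g) skew_hermitian_form) g = skew_hermitian_form)"

definition irr_classical_group :: "irr_classical \<Rightarrow> (nat + nat) qmat monoid"
  where "irr_classical_group c = matrix_group (basis c) (ground c) (identity c)"


section \<open>Matrix representations of scalars\<close>

fun quat_coord :: "quat \<Rightarrow> nat \<Rightarrow> real"
  where "quat_coord q s = [q_re q, q_i q, q_j q, q_k q] ! s"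

definition quat_unit :: "nat \<Rightarrow> quat"
  where "quat_unit s = [Quat 1 0 0 0, Quat 0 1 0 0, Quat 0 0 1 0, Quat 0 0 0 1] ! s"

text \<open>Left multiplication by \<open>q\<close> in the real basis \<open>1, i, j, k\<close> of the quaternions; its upper
  left \<open>2 \<times> 2\<close> part is the usual \<open>((x, -y), (y, x))\<close> if \<open>q = x + yi\<close> is complex.\<close>

definition real_rep :: "quat \<Rightarrow> nat \<Rightarrow> nat \<Rightarrow> quat"
  where "real_rep q s t = Quat (quat_coord (q * quat_unit t) s) 0 0 0"

text \<open>Left multiplication by \<open>q = a + bj\<close> (\<open>a\<close>, \<open>b\<close> complex) in the basis \<open>1, j\<close> of the
  quaternions as a right complex vector space: the matrix \<open>((a, -b), (cnj b, cnj a))\<close>.\<close>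

definition complex_rep :: "quat \<Rightarrow> nat \<Rightarrow> nat \<Rightarrow> quat"
  where "complex_rep q s t =
    (let a = Quat (q_re q) (q_i q) 0 0; b = Quat (q_j q) (q_k q) 0 0
     in [[a, - b], [quat_cnj b, quat_cnj a]] ! s ! t)"


section \<open>Maximal heavy subgroups\<close>

fun max_heavy :: "irr_classical \<Rightarrow> scalars list"
  where
    "max_heavy (GL_inf F) = [F]"
  | "max_heavy (U_inf_inf F) = [F, F]"
  | "max_heavy (U_fin_inf F p) = [F]"
  | "max_heavy Sp_R = [CC]"
  | "max_heavy Sp_C = [HH]"
  | "max_heavy O_C = [RR]"
  | "max_heavy SO_star = [CC]"

definition doubled :: "(quat \<Rightarrow> nat \<Rightarrow> nat \<Rightarrow> quat) \<Rightarrow> nat qmat \<Rightarrow> (nat + nat) qmat"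
  where "doubled \<rho> A =
    blocks (\<lambda>a b. \<rho> (A a b) 0 0) (\<lambda>a b. \<rho> (A a b) 0 1)
           (\<lambda>a b. \<rho> (A a b) 1 0) (\<lambda>a b. \<rho> (A a b) 1 1)"

text \<open>The inclusion of the maximal heavy subgroup; \<open>k r\<close> is the \<open>r\<close>-th factor. For \<open>SO*(2\<infinity>)\<close>,
  the unitary complex matrices are precisely the unitary quaternionic matrices commuting
  with \<open>i\<close>.\<close>

fun max_heavy_incl :: "irr_classical \<Rightarrow> (nat \<Rightarrow> nat qmat) \<Rightarrow> (nat + nat) qmat"
  where
    "max_heavy_incl (GL_inf F) k = blocks mat_one mat_zero mat_zero (k 0)"
  | "max_heavy_incl (U_inf_inf F) k = blocks (k 0) mat_zero mat_zero (k 1)"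
  | "max_heavy_incl (U_fin_inf F p) k = blocks mat_one mat_zero mat_zero (k 0)"
  | "max_heavy_incl Sp_R k = doubled real_rep (k 0)"
  | "max_heavy_incl Sp_C k = doubled complex_rep (k 0)"
  | "max_heavy_incl O_C k = blocks mat_one mat_zero mat_zero (k 0)"
  | "max_heavy_incl SO_star k = blocks mat_one mat_zero mat_zero (k 0)"


section \<open>Classical groups\<close>

definition classical_group :: "irr_classical list \<Rightarrow> (nat \<Rightarrow> (nat + nat) qmat) monoid"
  where "classical_group Gs =
    product_group {..<length Gs} (\<lambda>i. irr_classical_group (Gs ! i))"

text \<open>The factors of the maximal heavy subgroup \<open>K\<close> are indexed by pairs \<open>(i, r)\<close>: the
  \<open>r\<close>-th factor of the maximal heavy subgroup of the \<open>i\<close>-th factor.\<close>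

definition K_index :: "irr_classical list \<Rightarrow> (nat \<times> nat) set"
  where "K_index Gs = (SIGMA i : {..<length Gs}. {..<length (max_heavy (Gs ! i))})"

definition K_factor :: "irr_classical list \<Rightarrow> nat \<times> nat \<Rightarrow> scalars"
  where "K_factor Gs = (\<lambda>(i, r). max_heavy (Gs ! i) ! r)"

definition K_incl ::
    "irr_classical list \<Rightarrow> (nat \<times> nat \<Rightarrow> nat qmat) \<Rightarrow> (nat \<Rightarrow> (nat + nat) qmat)"
  where "K_incl Gs k = (\<lambda>i\<in>{..<length Gs}. max_heavy_incl (Gs ! i) (\<lambda>r. k (i, r)))"


section \<open>Straight homomorphisms\<close>

text \<open>\<open>trivial_hom F F' d \<rho>\<close>: a trivial homomorphism from the irreducible heavy group over \<open>F\<close>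
  to that over \<open>F'\<close>, which replaces each matrix entry \<open>q\<close> by the \<open>d \<times> d\<close> block \<open>\<rho> q\<close>.\<close>

inductive trivial_hom :: "scalars \<Rightarrow> scalars \<Rightarrow> nat \<Rightarrow> (quat \<Rightarrow> nat \<Rightarrow> nat \<Rightarrow> quat) \<Rightarrow> bool"
  where
    "trivial_hom F F 1 (\<lambda>q s t. q)"
  | "trivial_hom CC CC 1 (\<lambda>q s t. quat_cnj q)"
  | "trivial_hom RR CC 1 (\<lambda>q s t. q)"
  | "trivial_hom RR HH 1 (\<lambda>q s t. q)"
  | "trivial_hom CC HH 1 (\<lambda>q s t. q)"
  | "trivial_hom CC RR 2 real_rep"
  | "trivial_hom HH RR 4 real_rep"
  | "trivial_hom HH CC 2 complex_rep"

text \<open>The block diagonal form \<open>diag(1\<^sub>a, \<tau>\<^sub>1(g\<^bsub>m 1\<^esub>), \<dots>, \<tau>\<^sub>N(g\<^bsub>m N\<^esub>))\<close>, up to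
  an enumeration of the basis: \<open>\<phi> j n s\<close> is the number of the basis vector \<open>(n, s)\<close> of the
  \<open>j\<close>-th block, and the basis vectors that are not in any block (\<open>a\<close> of them, possibly
  none or infinitely many) are left fixed.\<close>

definition straight_irr ::
    "scalars list \<Rightarrow> scalars \<Rightarrow> ((nat \<Rightarrow> nat qmat) \<Rightarrow> nat qmat) \<Rightarrow> bool"
  where "straight_irr Ls F f \<longleftrightarrow>
    f \<in> hom (heavy_list Ls) (irr_heavy F) \<and>
    (\<exists>(N::nat) m d \<rho> \<phi>. 0 < N \<and>
      (\<forall>j<N. m j < length Ls \<and> trivial_hom (Ls ! m j) F (d j) (\<rho> j)) \<and>
      inj_on (\<lambda>(j, n, s). \<phi> j n s :: nat) (SIGMA j : {..<N}. (UNIV :: nat set) \<times> {..<d j}) \<and>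
      (\<forall>g \<in> carrier (heavy_list Ls).
        (\<forall>j<N. \<forall>n n'. \<forall>s<d j. \<forall>s'<d j.
            f g (\<phi> j n s) (\<phi> j n' s') = \<rho> j (g (m j) n n') s s') \<and>
        (\<forall>a b. (\<nexists>j n n' s s'. j < N \<and> s < d j \<and> s' < d j \<and> a = \<phi> j n s \<and> b = \<phi> j n' s') \<longrightarrow>
            f g a b = mat_one a b)))"

definition straight ::
    "scalars list \<Rightarrow> 'a set \<Rightarrow> ('a \<Rightarrow> scalars) \<Rightarrow> ((nat \<Rightarrow> nat qmat) \<Rightarrow> ('a \<Rightarrow> nat qmat)) \<Rightarrow> bool"
  where "straight Ls I F f \<longleftrightarrow>
    f \<in> hom (heavy_list Ls) (heavy I F) \<and> (\<forall>i\<in>I. straight_irr Ls (F i) (\<lambda>g. f g i))"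

type_synonym embedding = "(nat \<Rightarrow> nat qmat) \<Rightarrow> (nat \<times> nat \<Rightarrow> nat qmat)"

text \<open>\<open>G\<close> and \<open>L\<close> are given by the lists of their factors, and \<open>f\<close> is the embedding of \<open>L\<close>
  in the maximal heavy subgroup \<open>K\<close> of \<open>G\<close>.\<close>

definition GL_pair ::
    "irr_classical list \<Rightarrow> scalars list \<Rightarrow> embedding \<Rightarrow> bool"
  where "GL_pair Gs Ls f \<longleftrightarrow>
    straight Ls (K_index Gs) (K_factor Gs) f \<and> inj_on f (carrier (heavy_list Ls))"


section \<open>Double cosets and their product\<close>

definition double_coset :: "('a, 'b) monoid_scheme \<Rightarrow> 'a set \<Rightarrow> 'a \<Rightarrow> 'a set \<Rightarrow> 'a set"
  where "double_coset G H z K = (H #>\<^bsub>G\<^esub> z) <#>\<^bsub>G\<^esub> K"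

definition double_cosets :: "('a, 'b) monoid_scheme \<Rightarrow> 'a set \<Rightarrow> 'a set \<Rightarrow> 'a set set"
  where "double_cosets G H K = (\<lambda>z. double_coset G H z K) ` carrier G"

text \<open>A multi-index for \<open>L = L\<^sub>0 \<times> \<dots> \<times> L\<^bsub>p-1\<^esub>\<close> is a function on \<^typ>\<open>nat\<close>, of which only
  the values below \<open>p\<close> are ever used.\<close>

type_synonym multi_index = "nat \<Rightarrow> nat"

definition L_stab :: "scalars list \<Rightarrow> multi_index \<Rightarrow> (nat \<Rightarrow> nat qmat) set"
  where "L_stab Ls \<alpha> =
    {x \<in> carrier (heavy_list Ls). \<forall>j<length Ls. \<forall>b<\<alpha> j. \<forall>a. x j a b = mat_one a b}"

definition Theta1 :: "nat \<Rightarrow> nat \<Rightarrow> nat qmat"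
  where "Theta1 \<alpha> m a b =
    (if a < \<alpha> \<and> b = a
      \<or> \<alpha> \<le> a \<and> a < \<alpha> + m \<and> b = a + m
      \<or> \<alpha> + m \<le> a \<and> a < \<alpha> + 2 * m \<and> a = b + m
      \<or> \<alpha> + 2 * m \<le> a \<and> b = a
     then 1 else 0)"

definition Theta :: "scalars list \<Rightarrow> multi_index \<Rightarrow> multi_index \<Rightarrow> (nat \<Rightarrow> nat qmat)"
  where "Theta Ls \<alpha> m = (\<lambda>j\<in>{..<length Ls}. Theta1 (\<alpha> j) (m j))"

definition stabilizes_at :: "nat \<Rightarrow> (multi_index \<Rightarrow> 'x) \<Rightarrow> 'x \<Rightarrow> bool"
  where "stabilizes_at p X c \<longleftrightarrow> (\<exists>m0. \<forall>m. (\<forall>j<p. m0 j \<le> m j) \<longrightarrow> X m = c)"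

definition subgroup_L ::
    "irr_classical list \<Rightarrow> scalars list \<Rightarrow> embedding \<Rightarrow> multi_index
      \<Rightarrow> (nat \<Rightarrow> (nat + nat) qmat) set"
  where "subgroup_L Gs Ls f \<alpha> = (\<lambda>x. K_incl Gs (f x)) ` L_stab Ls \<alpha>"

definition cosets_L ::
    "irr_classical list \<Rightarrow> scalars list \<Rightarrow> embedding \<Rightarrow> multi_index \<Rightarrow> multi_index
      \<Rightarrow> (nat \<Rightarrow> (nat + nat) qmat) set set"
  where "cosets_L Gs Ls f \<gamma> \<alpha> =
    double_cosets (classical_group Gs) (subgroup_L Gs Ls f \<gamma>) (subgroup_L Gs Ls f \<alpha>)"

text \<open>The double coset of \<open>z\<^sub>m = g \<Theta>\<^sub>m h\<close>, with \<open>\<Theta>\<^sub>m\<close> taken for the multi-index \<open>\<beta>\<close>.\<close>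

definition coset_z ::
    "irr_classical list \<Rightarrow> scalars list \<Rightarrow> embedding \<Rightarrow> multi_index \<Rightarrow> multi_index \<Rightarrow> multi_index
      \<Rightarrow> (nat \<Rightarrow> (nat + nat) qmat) \<Rightarrow> (nat \<Rightarrow> (nat + nat) qmat) \<Rightarrow> multi_index
      \<Rightarrow> (nat \<Rightarrow> (nat + nat) qmat) set"
  where "coset_z Gs Ls f \<gamma> \<beta> \<alpha> g h m =
    double_coset (classical_group Gs) (subgroup_L Gs Ls f \<gamma>)
      (g \<otimes>\<^bsub>classical_group Gs\<^esub> K_incl Gs (f (Theta Ls \<beta> m)) \<otimes>\<^bsub>classical_group Gs\<^esub> h)
      (subgroup_L Gs Ls f \<alpha>)"

text \<open>The common limit for all choices of representatives.\<close>

definition coset_comp ::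
    "irr_classical list \<Rightarrow> scalars list \<Rightarrow> embedding \<Rightarrow> multi_index \<Rightarrow> multi_index \<Rightarrow> multi_index
      \<Rightarrow> (nat \<Rightarrow> (nat + nat) qmat) set \<Rightarrow> (nat \<Rightarrow> (nat + nat) qmat) set
      \<Rightarrow> (nat \<Rightarrow> (nat + nat) qmat) set"
  where "coset_comp Gs Ls f \<gamma> \<beta> \<alpha> A B =
    (THE Z. \<forall>g\<in>A. \<forall>h\<in>B. stabilizes_at (length Ls) (coset_z Gs Ls f \<gamma> \<beta> \<alpha> g h) Z)"

end

theory Submission
  imports Defs
begin

text \<open>
  Two facts about finiteness carry everything. An element \<open>g\<close> of \<open>G\<close> differs from the identity
  in finitely many basis vectors only, and a straight homomorphism is block diagonal, so \<open>g\<close>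
  commutes with the image of \<open>L\<^sup>N\<close> once the integer \<open>N\<close> (used for every factor of \<open>L\<close>) is large.
  And in \<open>L\<close> the involutions \<open>\<Theta>\<^sub>m\<close> for different \<open>m\<close> differ by permutations that move only basis
  vectors far away.

  Limits exist because \<open>\<Theta>\<^bsub>m'\<^esub> = u \<Theta>\<^sub>m v\<close> with \<open>u\<close>, \<open>v\<close> in \<open>L\<^sup>N\<close>: then
  \<open>g \<Theta>\<^bsub>m'\<^esub> h = u g \<Theta>\<^sub>m h v\<close> lies in the double coset of \<open>g \<Theta>\<^sub>m h\<close>.
  They do not depend on the representatives: conjugation by \<open>\<Theta>\<^sub>m\<close> moves a given element of
  \<open>L\<^sup>\<beta>\<close> far out, so for \<open>v\<close>, \<open>v'\<close> in \<open>L\<^sup>\<beta>\<close> one has \<open>v \<Theta>\<^sub>m v' = v x \<Theta>\<^sub>m = x v \<Theta>\<^sub>m = x \<Theta>\<^sub>m y\<close>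
  with \<open>x\<close>, \<open>y\<close> far enough out to pass through \<open>g\<close> and \<open>h\<close>.

  For associativity, \<open>(\<ff> \<circ> \<gg>) \<circ> \<hh>\<close> is represented by \<open>a \<Theta>\<^sub>m g \<Theta>\<^sub>n h\<close> with \<open>n\<close> much larger than
  \<open>m\<close>, and \<open>\<ff> \<circ> (\<gg> \<circ> \<hh>)\<close> by the same product with \<open>m\<close> much larger than \<open>n\<close>. In general the
  double coset may depend on \<open>(m, n)\<close> when \<open>m\<close> and \<open>n\<close> are close, because \<open>\<Theta>\<^sub>m\<close> can bring back a
  vector that \<open>\<Theta>\<^sub>n\<close> has sent away. The two regimes are connected by one jump: for
  \<open>m \<lless> n \<lless> m'\<close>, the involution \<open>v\<close> that swaps the stretch of basis vectors used by \<open>\<Theta>\<^sub>m\<close> with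
  the one used by \<open>\<Theta>\<^bsub>m'\<^esub>\<close> avoids the stretch used by \<open>\<Theta>\<^sub>n\<close>, so that \<open>v\<close> can be carried
  through \<open>\<Theta>\<^sub>n\<close> without coming near the supports of \<open>g\<close> and \<open>h\<close>.

  This argument is made once, in the locale \<open>theta_pair\<close>, from abstract properties of \<open>L\<close>,
  \<open>G\<close> and \<open>\<Theta>\<close>. The rest verifies these properties: \<open>Theta_push\<close> and \<open>Theta_relocate\<close> are
  computations with permutations, \<open>classical_group_commutes_far\<close> is the commutation property, and
  \<open>K_incl_hom\<close> says that the maximal heavy subgroups, given by explicit block matrices, do embed
  in the classical groups.
\<close>

section \<open>Double cosets\<close>

lemma double_coset_iff:
  "w \<in> double_coset G H z K \<longleftrightarrow> (\<exists>x\<in>H. \<exists>y\<in>K. w = x \<otimes>\<^bsub>G\<^esub> z \<otimes>\<^bsub>G\<^esub> y)"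
  by (auto simp: double_coset_def set_mult_def r_coset_def)

lemma (in group) double_coset_absorb:
  assumes H: "subgroup H G" and K: "subgroup K G"
    and "x \<in> H" "y \<in> K" "z \<in> carrier G"
  shows "double_coset G H (x \<otimes> z \<otimes> y) K = double_coset G H z K"
proof -
  have sub: "double_coset G H (x \<otimes> z \<otimes> y) K \<subseteq> double_coset G H z K"
    if "x \<in> H" "y \<in> K" "z \<in> carrier G" for x y z
  proof
    fix w assume "w \<in> double_coset G H (x \<otimes> z \<otimes> y) K"
    then obtain a b where ab: "a \<in> H" "b \<in> K" "w = a \<otimes> (x \<otimes> z \<otimes> y) \<otimes> b"
      by (auto simp: double_coset_iff)
    moreover have "a \<in> carrier G" "x \<in> carrier G" "y \<in> carrier G" "b \<in> carrier G"
      using ab that H K by (auto dest: subgroup.mem_carrier)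
    ultimately have "w = (a \<otimes> x) \<otimes> z \<otimes> (y \<otimes> b)"
      using that by (simp add: m_assoc)
    moreover have "a \<otimes> x \<in> H" "y \<otimes> b \<in> K"
      using ab that H K by (auto intro: subgroup.m_closed)
    ultimately show "w \<in> double_coset G H z K"
      unfolding double_coset_iff by blast
  qed
  have xy: "x \<in> carrier G" "y \<in> carrier G"
    using assms by (auto dest: subgroup.mem_carrier)
  have "inv x \<otimes> (x \<otimes> z \<otimes> y) \<otimes> inv y = z"
    using xy assms(5) by (simp add: m_assoc[symmetric]) (simp add: m_assoc)
  then have "double_coset G H z K \<subseteq> double_coset G H (x \<otimes> z \<otimes> y) K"
    using sub[of "inv x" "inv y" "x \<otimes> z \<otimes> y"] assms xy
    by (simp add: subgroup.m_inv_closed)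
  with sub[of x y z] assms show ?thesis by blast
qed

lemma stabilizes_at_unique:
  assumes "stabilizes_at p X c" "stabilizes_at p X d"
  shows "c = d"
proof -
  from assms obtain k l where
    "\<And>m. (\<forall>j<p. k j \<le> m j) \<Longrightarrow> X m = c" "\<And>m. (\<forall>j<p. l j \<le> m j) \<Longrightarrow> X m = d"
    unfolding stabilizes_at_def by blast
  from this(1)[of "\<lambda>j. max (k j) (l j)"] this(2)[of "\<lambda>j. max (k j) (l j)"] show ?thesis by simp
qed

section \<open>The limit of double cosets in an abstract setting\<close>

text \<open>The number of factors of \<open>L\<close> is \<open>p\<close>, and \<open>stab \<alpha>\<close> stands for \<open>L\<^sup>\<alpha>\<close>. In \<open>Th_relocate\<close> the size
  of \<open>\<Theta>\<close> jumps from \<open>m\<close> to \<open>m'\<close> across \<open>n\<close>; the gaps of length \<open>N\<close> separate the intervals of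
  basis vectors that the three involutions exchange with \<open>{\<gamma>..<N}\<close> and \<open>{\<beta>..<N}\<close>.\<close>

locale theta_pair = group_hom L G i for L (structure) and G (structure) and i +
  fixes p :: nat and stab :: "multi_index \<Rightarrow> 'a set" and Th :: "multi_index \<Rightarrow> multi_index \<Rightarrow> 'a"
  assumes stab_subgroup: "subgroup (stab \<alpha>) L"
    and stab_antimono: "(\<And>j. j < p \<Longrightarrow> \<beta> j \<le> \<alpha> j) \<Longrightarrow> stab \<alpha> \<subseteq> stab \<beta>"
    and Th_closed: "Th \<beta> m \<in> carrier L"
    and commute_far: "g \<in> carrier G \<Longrightarrow>
      \<exists>N. \<forall>x\<in>stab (\<lambda>_. N). i x \<otimes>\<^bsub>G\<^esub> g = g \<otimes>\<^bsub>G\<^esub> i x"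
    and Th_push: "v \<in> stab \<beta> \<Longrightarrow>
      \<exists>N. \<forall>m. (\<forall>j<p. N \<le> m j) \<longrightarrow>
        (\<exists>x\<in>stab m. Th \<beta> m \<otimes>\<^bsub>L\<^esub> v = x \<otimes>\<^bsub>L\<^esub> Th \<beta> m) \<and>
        (\<exists>y\<in>stab m. v \<otimes>\<^bsub>L\<^esub> Th \<beta> m = Th \<beta> m \<otimes>\<^bsub>L\<^esub> y)"
    and Th_relocate:
      "\<lbrakk>\<And>j. j < p \<Longrightarrow> \<gamma> j \<le> N \<and> \<beta> j \<le> N \<and> N \<le> m j \<and> m j + N \<le> n j \<and> n j + N \<le> m' j\<rbrakk> \<Longrightarrow>
       \<exists>u\<in>stab (\<lambda>_. N). \<exists>v\<in>stab (\<lambda>_. N). \<exists>w\<in>stab (\<lambda>_. N).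
         Th \<gamma> m' = u \<otimes>\<^bsub>L\<^esub> Th \<gamma> m \<otimes>\<^bsub>L\<^esub> v \<and> v \<otimes>\<^bsub>L\<^esub> Th \<beta> n = Th \<beta> n \<otimes>\<^bsub>L\<^esub> w"
begin

definition stabG where "stabG \<alpha> = i ` stab \<alpha>"

definition dcoset where "dcoset \<gamma> z \<alpha> = double_coset G (stabG \<gamma>) z (stabG \<alpha>)"

definition zcoset where "zcoset \<gamma> \<beta> \<alpha> g h m = dcoset \<gamma> (g \<otimes>\<^bsub>G\<^esub> i (Th \<beta> m) \<otimes>\<^bsub>G\<^esub> h) \<alpha>"

definition circ where "circ \<gamma> \<beta> \<alpha> A B =
  (THE Z. \<forall>g\<in>A. \<forall>h\<in>B. stabilizes_at p (zcoset \<gamma> \<beta> \<alpha> g h) Z)"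

lemma stab_closed: "x \<in> stab \<alpha> \<Longrightarrow> x \<in> carrier L"
  using stab_subgroup by (auto dest: subgroup.mem_carrier)

lemma stabG_subgroup: "subgroup (stabG \<alpha>) G"
  unfolding stabG_def by (rule subgroup_img_is_subgroup[OF stab_subgroup])

lemma i_closed [simp]: "x \<in> stab \<alpha> \<Longrightarrow> i x \<in> carrier G"
  by (auto dest: stab_closed)

lemma i_Th_closed [simp]: "i (Th \<beta> m) \<in> carrier G"
  by (simp add: Th_closed)

lemma dcoset_absorb:
  "\<lbrakk>x \<in> stab \<gamma>; y \<in> stab \<alpha>; z \<in> carrier G\<rbrakk> \<Longrightarrow> dcoset \<gamma> (i x \<otimes>\<^bsub>G\<^esub> z \<otimes>\<^bsub>G\<^esub> i y) \<alpha> = dcoset \<gamma> z \<alpha>"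
  unfolding dcoset_def using stabG_subgroup by (intro H.double_coset_absorb) (auto simp: stabG_def)

lemma dcoset_iff: "w \<in> dcoset \<gamma> z \<alpha> \<longleftrightarrow> (\<exists>x\<in>stab \<gamma>. \<exists>y\<in>stab \<alpha>. w = i x \<otimes>\<^bsub>G\<^esub> z \<otimes>\<^bsub>G\<^esub> i y)"
  by (auto simp: dcoset_def double_coset_iff stabG_def)

lemma dcoset_self: "z \<in> carrier G \<Longrightarrow> z \<in> dcoset \<gamma> z \<alpha>"
  unfolding dcoset_iff using stab_subgroup[THEN subgroup.one_closed] by force

lemma stab_constD: "x \<in> stab (\<lambda>_. N) \<Longrightarrow> (\<And>j. j < p \<Longrightarrow> \<alpha> j \<le> N) \<Longrightarrow> x \<in> stab \<alpha>"
  using stab_antimono[of \<alpha> "\<lambda>_. N"] by auto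

lemma bound_ex: "\<exists>N. \<forall>j<p. \<alpha> j \<le> (N::nat)"
  by (rule exI[of _ "\<Sum>j<p. \<alpha> j"]) (auto intro: member_le_sum)

text \<open>The stabilizers shrink as \<open>N\<close> grows, so the thresholds of finitely many elements have a common
  bound.\<close>

lemma commute_common:
  assumes "finite S" "S \<subseteq> carrier G"
  shows "\<exists>N. \<forall>g\<in>S. \<forall>x\<in>stab (\<lambda>_. N). i x \<otimes>\<^bsub>G\<^esub> g = g \<otimes>\<^bsub>G\<^esub> i x"
  using assms
proof (induction S)
  case (insert g S)
  then obtain N where N: "\<forall>g\<in>S. \<forall>x\<in>stab (\<lambda>_. N). i x \<otimes>\<^bsub>G\<^esub> g = g \<otimes>\<^bsub>G\<^esub> i x" by auto
  obtain M where M: "\<forall>x\<in>stab (\<lambda>_. M). i x \<otimes>\<^bsub>G\<^esub> g = g \<otimes>\<^bsub>G\<^esub> i x"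
    using commute_far[of g] insert by blast
  show ?case
    by (rule exI[of _ "max M N"])
      (use M N stab_antimono[of "\<lambda>_. M" "\<lambda>_. max M N"] stab_antimono[of "\<lambda>_. N" "\<lambda>_. max M N"] in auto)
qed auto

text \<open>The step that makes the product associative: \<open>v\<close> passes through \<open>g\<close> because it lies in \<open>L\<^sup>N\<close>,
  then through \<open>\<Theta>\<^sub>n\<close> at the price of becoming another element \<open>w\<close> of \<open>L\<^sup>N\<close>, and finally through
  \<open>h\<close>.\<close>

lemma relocate:
  assumes G: "a \<in> carrier G" "g \<in> carrier G" "h \<in> carrier G"
    and comm: "\<And>b x. b \<in> {a, g, h} \<Longrightarrow> x \<in> stab (\<lambda>_. N) \<Longrightarrow> i x \<otimes>\<^bsub>G\<^esub> b = b \<otimes>\<^bsub>G\<^esub> i x"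
    and N: "\<And>j. j < p \<Longrightarrow> \<alpha> j \<le> N \<and> \<beta> j \<le> N \<and> \<gamma> j \<le> N \<and> \<delta> j \<le> N"
    and mn: "\<And>j. j < p \<Longrightarrow> N \<le> m j \<and> m j + N \<le> n j \<and> n j + N \<le> m' j"
  shows "dcoset \<delta> (a \<otimes>\<^bsub>G\<^esub> i (Th \<gamma> m') \<otimes>\<^bsub>G\<^esub> (g \<otimes>\<^bsub>G\<^esub> i (Th \<beta> n) \<otimes>\<^bsub>G\<^esub> h)) \<alpha> =
    dcoset \<delta> (a \<otimes>\<^bsub>G\<^esub> i (Th \<gamma> m) \<otimes>\<^bsub>G\<^esub> (g \<otimes>\<^bsub>G\<^esub> i (Th \<beta> n) \<otimes>\<^bsub>G\<^esub> h)) \<alpha>"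
proof -
  obtain u v w where uvw: "u \<in> stab (\<lambda>_. N)" "v \<in> stab (\<lambda>_. N)" "w \<in> stab (\<lambda>_. N)"
    and e: "Th \<gamma> m' = u \<otimes>\<^bsub>L\<^esub> Th \<gamma> m \<otimes>\<^bsub>L\<^esub> v" "v \<otimes>\<^bsub>L\<^esub> Th \<beta> n = Th \<beta> n \<otimes>\<^bsub>L\<^esub> w"
    using Th_relocate[of \<gamma> N \<beta> m n m'] N mn by blast
  note cl = uvw[THEN stab_closed] uvw[THEN i_closed]
  have e1: "i (Th \<gamma> m') = i u \<otimes>\<^bsub>G\<^esub> i (Th \<gamma> m) \<otimes>\<^bsub>G\<^esub> i v"
    using cl by (simp add: e(1) Th_closed)
  have e2: "i v \<otimes>\<^bsub>G\<^esub> i (Th \<beta> n) = i (Th \<beta> n) \<otimes>\<^bsub>G\<^esub> i w"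
    using cl by (simp add: e(2) Th_closed flip: hom_mult)
  let ?z = "a \<otimes>\<^bsub>G\<^esub> i (Th \<gamma> m) \<otimes>\<^bsub>G\<^esub> (g \<otimes>\<^bsub>G\<^esub> i (Th \<beta> n) \<otimes>\<^bsub>G\<^esub> h)"
  have "a \<otimes>\<^bsub>G\<^esub> i (Th \<gamma> m') \<otimes>\<^bsub>G\<^esub> (g \<otimes>\<^bsub>G\<^esub> i (Th \<beta> n) \<otimes>\<^bsub>G\<^esub> h)
    = (a \<otimes>\<^bsub>G\<^esub> i u) \<otimes>\<^bsub>G\<^esub> i (Th \<gamma> m) \<otimes>\<^bsub>G\<^esub> ((i v \<otimes>\<^bsub>G\<^esub> g) \<otimes>\<^bsub>G\<^esub> i (Th \<beta> n) \<otimes>\<^bsub>G\<^esub> h)"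
    using cl G by (simp add: e1 H.m_assoc)
  also have "\<dots> = (i u \<otimes>\<^bsub>G\<^esub> a) \<otimes>\<^bsub>G\<^esub> i (Th \<gamma> m) \<otimes>\<^bsub>G\<^esub> (g \<otimes>\<^bsub>G\<^esub> (i v \<otimes>\<^bsub>G\<^esub> i (Th \<beta> n)) \<otimes>\<^bsub>G\<^esub> h)"
    using cl G comm[of a u] comm[of g v] uvw by (simp add: H.m_assoc)
  also have "\<dots> = (i u \<otimes>\<^bsub>G\<^esub> a) \<otimes>\<^bsub>G\<^esub> i (Th \<gamma> m) \<otimes>\<^bsub>G\<^esub> (g \<otimes>\<^bsub>G\<^esub> i (Th \<beta> n) \<otimes>\<^bsub>G\<^esub> (i w \<otimes>\<^bsub>G\<^esub> h))"
    using cl G by (simp add: e2 H.m_assoc)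
  also have "\<dots> = i u \<otimes>\<^bsub>G\<^esub> ?z \<otimes>\<^bsub>G\<^esub> i w"
    using cl G comm[of h w] uvw by (simp add: H.m_assoc)
  finally show ?thesis
    using uvw G N dcoset_absorb[of u \<delta> w \<alpha> ?z] stab_constD[of _ N] by simp
qed

text \<open>Beyond \<open>N\<close> all values agree with that at a much larger multi-index, since \<open>\<Theta>\<^bsub>m'\<^esub>\<close> and \<open>\<Theta>\<^sub>m\<close>
  differ by factors in \<open>L\<^sup>N\<close>, which commute with \<open>g\<close> and \<open>h\<close>.\<close>

lemma zcoset_eventually_constant:
  assumes G: "g \<in> carrier G" "h \<in> carrier G"
  shows "\<exists>N. \<forall>m m'. (\<forall>j<p. N \<le> m j) \<longrightarrow> (\<forall>j<p. N \<le> m' j) \<longrightarrow>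
    zcoset \<gamma> \<beta> \<alpha> g h m = zcoset \<gamma> \<beta> \<alpha> g h m'"
proof -
  obtain N1 where N1: "\<forall>g\<in>{g, h}. \<forall>x\<in>stab (\<lambda>_. N1). i x \<otimes>\<^bsub>G\<^esub> g = g \<otimes>\<^bsub>G\<^esub> i x"
    using commute_common[of "{g, h}"] G by auto
  obtain N2 where N2: "\<forall>j<p. \<alpha> j + \<beta> j + \<gamma> j \<le> N2"
    using bound_ex[of "\<lambda>j. \<alpha> j + \<beta> j + \<gamma> j"] by auto
  define N where "N = max N1 N2"
  have comm: "i x \<otimes>\<^bsub>G\<^esub> b = b \<otimes>\<^bsub>G\<^esub> i x" if "b \<in> {g, h}" "x \<in> stab (\<lambda>_. N)" for b x
    using N1 that stab_constD[OF that(2), of "\<lambda>_. N1"] by (auto simp: N_def)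
  have N: "\<And>j. j < p \<Longrightarrow> \<alpha> j \<le> N \<and> \<beta> j \<le> N \<and> \<gamma> j \<le> N"
    using N2 by (fastforce simp: N_def)
  have step: "zcoset \<gamma> \<beta> \<alpha> g h m' = zcoset \<gamma> \<beta> \<alpha> g h m"
    if mm: "\<And>j. j < p \<Longrightarrow> N \<le> m j \<and> m j + N + N \<le> m' j" for m m'
  proof -
    obtain u v where uv: "u \<in> stab (\<lambda>_. N)" "v \<in> stab (\<lambda>_. N)"
      and e: "Th \<beta> m' = u \<otimes>\<^bsub>L\<^esub> Th \<beta> m \<otimes>\<^bsub>L\<^esub> v"
      \<comment> \<open>There is no second involution here; the size \<open>m + N\<close> of one is chosen to fit in between.\<close>
      using Th_relocate[of \<beta> N \<beta> m "\<lambda>j. m j + N" m'] N mm by auto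
    note cl = uv[THEN stab_closed] uv[THEN i_closed]
    let ?z = "g \<otimes>\<^bsub>G\<^esub> i (Th \<beta> m) \<otimes>\<^bsub>G\<^esub> h"
    have "g \<otimes>\<^bsub>G\<^esub> i (Th \<beta> m') \<otimes>\<^bsub>G\<^esub> h = (g \<otimes>\<^bsub>G\<^esub> i u) \<otimes>\<^bsub>G\<^esub> i (Th \<beta> m) \<otimes>\<^bsub>G\<^esub> (i v \<otimes>\<^bsub>G\<^esub> h)"
      using cl G by (simp add: e Th_closed H.m_assoc)
    also have "\<dots> = (i u \<otimes>\<^bsub>G\<^esub> g) \<otimes>\<^bsub>G\<^esub> i (Th \<beta> m) \<otimes>\<^bsub>G\<^esub> (h \<otimes>\<^bsub>G\<^esub> i v)"
      using comm uv by simp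
    also have "\<dots> = i u \<otimes>\<^bsub>G\<^esub> ?z \<otimes>\<^bsub>G\<^esub> i v"
      using cl G by (simp add: H.m_assoc)
    finally show ?thesis
      unfolding zcoset_def using uv G N dcoset_absorb[of u \<gamma> v \<alpha> ?z] stab_constD[of _ N] by simp
  qed
  show ?thesis
  proof (intro exI[of _ N] allI impI)
    fix m m' :: multi_index
    assume "\<forall>j<p. N \<le> m j" "\<forall>j<p. N \<le> m' j"
    \<comment> \<open>\<open>step\<close> needs a large gap, so both values are compared with the value far beyond \<open>m\<close> and \<open>m'\<close>.\<close>
    then show "zcoset \<gamma> \<beta> \<alpha> g h m = zcoset \<gamma> \<beta> \<alpha> g h m'"
      using step[of m "\<lambda>j. m j + m' j + N + N"] step[of m' "\<lambda>j. m j + m' j + N + N"] by simp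
  qed
qed

text \<open>With \<open>g' = u g v\<close> and \<open>h' = v' h w\<close> the inner factors \<open>v\<close> and \<open>v'\<close> have to be absorbed. Pushing
  \<open>v'\<close> to the left of \<open>\<Theta>\<^sub>m\<close> turns it into an \<open>x\<close> so far out that it commutes with \<open>v\<close>; then \<open>v\<close>
  can be pushed to the right of \<open>\<Theta>\<^sub>m\<close>, and both results commute with \<open>g\<close> and \<open>h\<close>.\<close>

lemma zcoset_change_representatives:
  assumes G: "g \<in> carrier G" "h \<in> carrier G"
    and g': "g' \<in> dcoset \<gamma> g \<beta>" and h': "h' \<in> dcoset \<beta> h \<alpha>"
  shows "\<exists>N. \<forall>m. (\<forall>j<p. N \<le> m j) \<longrightarrow> zcoset \<gamma> \<beta> \<alpha> g' h' m = zcoset \<gamma> \<beta> \<alpha> g h m"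
proof -
  obtain u v where uv: "u \<in> stab \<gamma>" "v \<in> stab \<beta>" "g' = i u \<otimes>\<^bsub>G\<^esub> g \<otimes>\<^bsub>G\<^esub> i v"
    using g' by (auto simp: dcoset_iff)
  obtain v' w where vw: "v' \<in> stab \<beta>" "w \<in> stab \<alpha>" "h' = i v' \<otimes>\<^bsub>G\<^esub> h \<otimes>\<^bsub>G\<^esub> i w"
    using h' by (auto simp: dcoset_iff)
  obtain N1 where N1: "\<forall>b\<in>{g, h, i v}. \<forall>x\<in>stab (\<lambda>_. N1). i x \<otimes>\<^bsub>G\<^esub> b = b \<otimes>\<^bsub>G\<^esub> i x"
    using commute_common[of "{g, h, i v}"] G uv by auto
  obtain N2 where N2: "\<forall>j<p. \<alpha> j + \<gamma> j \<le> N2"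
    using bound_ex[of "\<lambda>j. \<alpha> j + \<gamma> j"] by auto
  obtain N3 where N3: "\<And>m. \<forall>j<p. N3 \<le> m j \<Longrightarrow>
      \<exists>x\<in>stab m. Th \<beta> m \<otimes>\<^bsub>L\<^esub> v' = x \<otimes>\<^bsub>L\<^esub> Th \<beta> m"
    using Th_push[OF vw(1)] by blast
  obtain N4 where N4: "\<And>m. \<forall>j<p. N4 \<le> m j \<Longrightarrow>
      \<exists>y\<in>stab m. v \<otimes>\<^bsub>L\<^esub> Th \<beta> m = Th \<beta> m \<otimes>\<^bsub>L\<^esub> y"
    using Th_push[OF uv(2)] by blast
  show ?thesis
  proof (intro exI[of _ "N1 + N2 + N3 + N4"] allI impI)
    fix m assume m: "\<forall>j<p. N1 + N2 + N3 + N4 \<le> m j"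
    obtain x where x: "x \<in> stab m" "Th \<beta> m \<otimes>\<^bsub>L\<^esub> v' = x \<otimes>\<^bsub>L\<^esub> Th \<beta> m"
      using N3[of m] m by fastforce
    obtain y where y: "y \<in> stab m" "v \<otimes>\<^bsub>L\<^esub> Th \<beta> m = Th \<beta> m \<otimes>\<^bsub>L\<^esub> y"
      using N4[of m] m by fastforce
    have le: "N1 \<le> m j \<and> \<alpha> j \<le> m j \<and> \<gamma> j \<le> m j" if "j < p" for j
      using m[rule_format, OF that] N2[rule_format, OF that] by linarith
    have far: "s \<in> stab (\<lambda>_. N1)" "s \<in> stab \<alpha>" "s \<in> stab \<gamma>" if "s \<in> stab m" for s
      using that le stab_antimono[of "\<lambda>_. N1" m] stab_antimono[of \<alpha> m] stab_antimono[of \<gamma> m]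
      by auto
    note cl = uv(1,2)[THEN i_closed] vw(1,2)[THEN i_closed] x(1)[THEN i_closed] y(1)[THEN i_closed]
      uv(1,2)[THEN stab_closed] vw(1,2)[THEN stab_closed] x(1)[THEN stab_closed] y(1)[THEN stab_closed]
    have ex: "i (Th \<beta> m) \<otimes>\<^bsub>G\<^esub> i v' = i x \<otimes>\<^bsub>G\<^esub> i (Th \<beta> m)"
      using cl by (simp add: x(2) Th_closed flip: hom_mult)
    have ey: "i v \<otimes>\<^bsub>G\<^esub> i (Th \<beta> m) = i (Th \<beta> m) \<otimes>\<^bsub>G\<^esub> i y"
      using cl by (simp add: y(2) Th_closed flip: hom_mult)
    have comm: "i s \<otimes>\<^bsub>G\<^esub> b = b \<otimes>\<^bsub>G\<^esub> i s" if "s \<in> stab m" "b \<in> {g, h, i v}" for s b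
      using N1 far that by blast
    let ?z = "g \<otimes>\<^bsub>G\<^esub> i (Th \<beta> m) \<otimes>\<^bsub>G\<^esub> h"
    have "g' \<otimes>\<^bsub>G\<^esub> i (Th \<beta> m) \<otimes>\<^bsub>G\<^esub> h'
      = i u \<otimes>\<^bsub>G\<^esub> (g \<otimes>\<^bsub>G\<^esub> i v \<otimes>\<^bsub>G\<^esub> (i (Th \<beta> m) \<otimes>\<^bsub>G\<^esub> i v') \<otimes>\<^bsub>G\<^esub> h) \<otimes>\<^bsub>G\<^esub> i w"
      using cl G by (simp add: uv(3) vw(3) H.m_assoc)
    also have "g \<otimes>\<^bsub>G\<^esub> i v \<otimes>\<^bsub>G\<^esub> (i (Th \<beta> m) \<otimes>\<^bsub>G\<^esub> i v') \<otimes>\<^bsub>G\<^esub> h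
      = g \<otimes>\<^bsub>G\<^esub> (i v \<otimes>\<^bsub>G\<^esub> i x) \<otimes>\<^bsub>G\<^esub> i (Th \<beta> m) \<otimes>\<^bsub>G\<^esub> h"
      using cl G by (simp add: ex H.m_assoc)
    also have "i v \<otimes>\<^bsub>G\<^esub> i x = i x \<otimes>\<^bsub>G\<^esub> i v"
      using comm[OF x(1), of "i v"] by simp
    also have "g \<otimes>\<^bsub>G\<^esub> (i x \<otimes>\<^bsub>G\<^esub> i v) \<otimes>\<^bsub>G\<^esub> i (Th \<beta> m) \<otimes>\<^bsub>G\<^esub> h
      = (g \<otimes>\<^bsub>G\<^esub> i x) \<otimes>\<^bsub>G\<^esub> (i v \<otimes>\<^bsub>G\<^esub> i (Th \<beta> m)) \<otimes>\<^bsub>G\<^esub> h"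
      using cl G by (simp add: H.m_assoc)
    also have "\<dots> = (i x \<otimes>\<^bsub>G\<^esub> g) \<otimes>\<^bsub>G\<^esub> i (Th \<beta> m) \<otimes>\<^bsub>G\<^esub> (i y \<otimes>\<^bsub>G\<^esub> h)"
      using cl G comm[OF x(1), of g] by (simp add: ey H.m_assoc)
    also have "\<dots> = i x \<otimes>\<^bsub>G\<^esub> ?z \<otimes>\<^bsub>G\<^esub> i y"
      using cl G comm[OF y(1), of h] by (simp add: H.m_assoc)
    finally have "zcoset \<gamma> \<beta> \<alpha> g' h' m = dcoset \<gamma> (i x \<otimes>\<^bsub>G\<^esub> ?z \<otimes>\<^bsub>G\<^esub> i y) \<alpha>"
      using dcoset_absorb[of u \<gamma> w \<alpha> "i x \<otimes>\<^bsub>G\<^esub> ?z \<otimes>\<^bsub>G\<^esub> i y"] uv vw cl G by (simp add: zcoset_def)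
    also have "\<dots> = zcoset \<gamma> \<beta> \<alpha> g h m"
      using dcoset_absorb[of x \<gamma> y \<alpha> ?z] x y far cl G by (simp add: zcoset_def)
    finally show "zcoset \<gamma> \<beta> \<alpha> g' h' m = zcoset \<gamma> \<beta> \<alpha> g h m" .
  qed
qed

lemma circ_limit:
  assumes G: "g \<in> carrier G" "h \<in> carrier G"
  shows "\<exists>N. \<forall>m. (\<forall>j<p. N \<le> m j) \<longrightarrow>
      circ \<gamma> \<beta> \<alpha> (dcoset \<gamma> g \<beta>) (dcoset \<beta> h \<alpha>) = dcoset \<gamma> (g \<otimes>\<^bsub>G\<^esub> i (Th \<beta> m) \<otimes>\<^bsub>G\<^esub> h) \<alpha>"
    and "g' \<in> dcoset \<gamma> g \<beta> \<Longrightarrow> h' \<in> dcoset \<beta> h \<alpha> \<Longrightarrow>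
      stabilizes_at p (zcoset \<gamma> \<beta> \<alpha> g' h') (circ \<gamma> \<beta> \<alpha> (dcoset \<gamma> g \<beta>) (dcoset \<beta> h \<alpha>))"
proof -
  obtain N where N: "\<And>m m'. \<forall>j<p. N \<le> m j \<Longrightarrow> \<forall>j<p. N \<le> m' j \<Longrightarrow>
      zcoset \<gamma> \<beta> \<alpha> g h m = zcoset \<gamma> \<beta> \<alpha> g h m'"
    using zcoset_eventually_constant[OF G] by blast
  define Z where "Z = zcoset \<gamma> \<beta> \<alpha> g h (\<lambda>_. N)"
  have Z: "zcoset \<gamma> \<beta> \<alpha> g h m = Z" if "\<forall>j<p. N \<le> m j" for m
    unfolding Z_def by (rule N[OF that]) simp
  have stable: "stabilizes_at p (zcoset \<gamma> \<beta> \<alpha> g' h') Z"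
    if gh: "g' \<in> dcoset \<gamma> g \<beta>" "h' \<in> dcoset \<beta> h \<alpha>" for g' h'
  proof -
    obtain M where M: "\<And>m. \<forall>j<p. M \<le> m j \<Longrightarrow> zcoset \<gamma> \<beta> \<alpha> g' h' m = zcoset \<gamma> \<beta> \<alpha> g h m"
      using zcoset_change_representatives[OF G gh] by blast
    show ?thesis
      unfolding stabilizes_at_def by (rule exI[of _ "\<lambda>_. max M N"]) (use M Z in auto)
  qed
  have "circ \<gamma> \<beta> \<alpha> (dcoset \<gamma> g \<beta>) (dcoset \<beta> h \<alpha>) = Z"
    unfolding circ_def
  proof (rule the_equality)
    fix Y assume Y: "\<forall>g\<in>dcoset \<gamma> g \<beta>. \<forall>h\<in>dcoset \<beta> h \<alpha>. stabilizes_at p (zcoset \<gamma> \<beta> \<alpha> g h) Y"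
    have "g \<in> dcoset \<gamma> g \<beta>" "h \<in> dcoset \<beta> h \<alpha>" using dcoset_self G by auto
    then show "Y = Z" by (rule stabilizes_at_unique[OF Y[rule_format] stable]) fact+
  qed (use stable in blast)
  then show "\<exists>N. \<forall>m. (\<forall>j<p. N \<le> m j) \<longrightarrow>
      circ \<gamma> \<beta> \<alpha> (dcoset \<gamma> g \<beta>) (dcoset \<beta> h \<alpha>) = dcoset \<gamma> (g \<otimes>\<^bsub>G\<^esub> i (Th \<beta> m) \<otimes>\<^bsub>G\<^esub> h) \<alpha>"
    and "g' \<in> dcoset \<gamma> g \<beta> \<Longrightarrow> h' \<in> dcoset \<beta> h \<alpha> \<Longrightarrow>
      stabilizes_at p (zcoset \<gamma> \<beta> \<alpha> g' h') (circ \<gamma> \<beta> \<alpha> (dcoset \<gamma> g \<beta>) (dcoset \<beta> h \<alpha>))"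
    using Z stable by (auto simp: zcoset_def)
qed

text \<open>The sizes are chosen in the order \<open>m\<close>, \<open>n\<close>, \<open>m'\<close>: \<open>n\<close> is large enough after \<open>m\<close> for the left
  product and large enough by itself for the inner right product, and \<open>m'\<close> is large enough after
  \<open>n\<close> for the right product.\<close>

lemma circ_assoc:
  assumes G: "a \<in> carrier G" "g \<in> carrier G" "h \<in> carrier G"
  shows "circ \<delta> \<beta> \<alpha> (circ \<delta> \<gamma> \<beta> (dcoset \<delta> a \<gamma>) (dcoset \<gamma> g \<beta>)) (dcoset \<beta> h \<alpha>) =
    circ \<delta> \<gamma> \<alpha> (dcoset \<delta> a \<gamma>) (circ \<gamma> \<beta> \<alpha> (dcoset \<gamma> g \<beta>) (dcoset \<beta> h \<alpha>))"
proof -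
  obtain N1 where N1: "\<forall>g\<in>{a, g, h}. \<forall>x\<in>stab (\<lambda>_. N1). i x \<otimes>\<^bsub>G\<^esub> g = g \<otimes>\<^bsub>G\<^esub> i x"
    using commute_common[of "{a, g, h}"] G by auto
  obtain N2 where N2: "\<forall>j<p. \<alpha> j + \<beta> j + \<gamma> j + \<delta> j \<le> N2"
    using bound_ex[of "\<lambda>j. \<alpha> j + \<beta> j + \<gamma> j + \<delta> j"] by auto
  define N where "N = max N1 N2"
  have comm: "i x \<otimes>\<^bsub>G\<^esub> b = b \<otimes>\<^bsub>G\<^esub> i x" if "b \<in> {a, g, h}" "x \<in> stab (\<lambda>_. N)" for b x
    using N1 that stab_constD[OF that(2), of "\<lambda>_. N1"] by (auto simp: N_def)
  have N: "\<alpha> j \<le> N \<and> \<beta> j \<le> N \<and> \<gamma> j \<le> N \<and> \<delta> j \<le> N" if "j < p" for j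
  proof -
    have "\<alpha> j + \<beta> j + \<gamma> j + \<delta> j \<le> N" using N2 that by (auto simp: N_def max_def intro: order_trans)
    then show ?thesis by linarith
  qed
  obtain M1 where M1: "\<And>m. \<forall>j<p. M1 \<le> m j \<Longrightarrow>
      circ \<delta> \<gamma> \<beta> (dcoset \<delta> a \<gamma>) (dcoset \<gamma> g \<beta>) = dcoset \<delta> (a \<otimes>\<^bsub>G\<^esub> i (Th \<gamma> m) \<otimes>\<^bsub>G\<^esub> g) \<beta>"
    using circ_limit(1)[OF G(1,2)] by blast
  define m where "m = (\<lambda>_::nat. N + M1)"
  let ?ag = "a \<otimes>\<^bsub>G\<^esub> i (Th \<gamma> m) \<otimes>\<^bsub>G\<^esub> g"
  obtain M2 where M2: "\<And>n. \<forall>j<p. M2 \<le> n j \<Longrightarrow>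
      circ \<delta> \<beta> \<alpha> (dcoset \<delta> ?ag \<beta>) (dcoset \<beta> h \<alpha>) = dcoset \<delta> (?ag \<otimes>\<^bsub>G\<^esub> i (Th \<beta> n) \<otimes>\<^bsub>G\<^esub> h) \<alpha>"
    using circ_limit(1)[of ?ag h] G by (metis H.m_closed i_Th_closed)
  obtain M3 where M3: "\<And>n. \<forall>j<p. M3 \<le> n j \<Longrightarrow>
      circ \<gamma> \<beta> \<alpha> (dcoset \<gamma> g \<beta>) (dcoset \<beta> h \<alpha>) = dcoset \<gamma> (g \<otimes>\<^bsub>G\<^esub> i (Th \<beta> n) \<otimes>\<^bsub>G\<^esub> h) \<alpha>"
    using circ_limit(1)[OF G(2,3)] by blast
  define n where "n = (\<lambda>_::nat. M2 + M3 + (N + M1) + N)"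
  let ?gh = "g \<otimes>\<^bsub>G\<^esub> i (Th \<beta> n) \<otimes>\<^bsub>G\<^esub> h"
  obtain M4 where M4: "\<And>m. \<forall>j<p. M4 \<le> m j \<Longrightarrow>
      circ \<delta> \<gamma> \<alpha> (dcoset \<delta> a \<gamma>) (dcoset \<gamma> ?gh \<alpha>) = dcoset \<delta> (a \<otimes>\<^bsub>G\<^esub> i (Th \<gamma> m) \<otimes>\<^bsub>G\<^esub> ?gh) \<alpha>"
    using circ_limit(1)[of a ?gh] G by (metis H.m_closed i_Th_closed)
  define m' where "m' = (\<lambda>j::nat. M4 + n j + N)"
  have "circ \<delta> \<beta> \<alpha> (circ \<delta> \<gamma> \<beta> (dcoset \<delta> a \<gamma>) (dcoset \<gamma> g \<beta>)) (dcoset \<beta> h \<alpha>)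
      = dcoset \<delta> (?ag \<otimes>\<^bsub>G\<^esub> i (Th \<beta> n) \<otimes>\<^bsub>G\<^esub> h) \<alpha>"
    using M1[of m] M2[of n] by (simp add: m_def n_def)
  also have "\<dots> = dcoset \<delta> (a \<otimes>\<^bsub>G\<^esub> i (Th \<gamma> m) \<otimes>\<^bsub>G\<^esub> ?gh) \<alpha>"
    using G by (simp add: H.m_assoc)
  also have "\<dots> = dcoset \<delta> (a \<otimes>\<^bsub>G\<^esub> i (Th \<gamma> m') \<otimes>\<^bsub>G\<^esub> ?gh) \<alpha>"
    by (rule relocate[symmetric]) (use G comm N in \<open>auto simp: m_def n_def m'_def\<close>)
  also have "\<dots> = circ \<delta> \<gamma> \<alpha> (dcoset \<delta> a \<gamma>) (dcoset \<gamma> ?gh \<alpha>)"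
    using M4[of m'] by (simp add: m'_def)
  also have "dcoset \<gamma> ?gh \<alpha> = circ \<gamma> \<beta> \<alpha> (dcoset \<gamma> g \<beta>) (dcoset \<beta> h \<alpha>)"
    using M3[of n] by (simp add: n_def)
  finally show ?thesis .
qed

end

section \<open>Quaternions\<close>

lemma quat_cnj_add: "quat_cnj (x + y) = quat_cnj x + quat_cnj y"
  and quat_cnj_mult: "quat_cnj (x * y) = quat_cnj y * quat_cnj x"
  and quat_cnj_0 [simp]: "quat_cnj 0 = 0"
  and quat_cnj_1 [simp]: "quat_cnj 1 = 1"
  and quat_cnj_cnj [simp]: "quat_cnj (quat_cnj x) = x"
  by (simp_all add: quat_cnj_def quat_defs algebra_simps)

lemma scalar_set_0 [simp]: "0 \<in> scalar_set F"
  and scalar_set_1 [simp]: "1 \<in> scalar_set F"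
  by (cases F; simp add: quat_defs)+

lemma scalar_set_add: "x \<in> scalar_set F \<Longrightarrow> y \<in> scalar_set F \<Longrightarrow> x + y \<in> scalar_set F"
  and scalar_set_mult: "x \<in> scalar_set F \<Longrightarrow> y \<in> scalar_set F \<Longrightarrow> x * y \<in> scalar_set F"
  and scalar_set_cnj: "x \<in> scalar_set F \<Longrightarrow> quat_cnj x \<in> scalar_set F"
  by (cases F; simp add: quat_defs quat_cnj_def)+

lemma scalar_set_sum: "(\<And>c. c \<in> S \<Longrightarrow> h c \<in> scalar_set F) \<Longrightarrow> sum h S \<in> scalar_set F"
  by (induction S rule: infinite_finite_induct) (auto intro: scalar_set_add)

lemma scalar_set_commute:
  "F \<noteq> HH \<Longrightarrow> x \<in> scalar_set F \<Longrightarrow> y \<in> scalar_set F \<Longrightarrow> x * y = y * x"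
  by (cases F) (simp_all add: quat_defs algebra_simps)

section \<open>Row-finite matrices\<close>

definition row_finite :: "'i qmat \<Rightarrow> bool"
  where "row_finite A \<longleftrightarrow> (\<forall>a. finite {c. A a c \<noteq> 0})"

lemma mat_mult_eq_sum:
  assumes "finite S" "\<And>c. c \<notin> S \<Longrightarrow> A a c = 0"
  shows "mat_mult A B a b = (\<Sum>c\<in>S. A a c * B c b)"
  unfolding mat_mult_def by (rule sum.mono_neutral_left) (use assms in auto)

lemma row_finite_one [simp]: "row_finite mat_one"
  by (simp add: row_finite_def mat_one_def)

lemma row_finite_mult:
  assumes "row_finite A" "row_finite B"
  shows "row_finite (mat_mult A B)"
  unfolding row_finite_def
proof
  fix a
  have "{b. mat_mult A B a b \<noteq> 0} \<subseteq> (\<Union>c\<in>{c. A a c \<noteq> 0}. {b. B c b \<noteq> 0})"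
  proof
    fix b assume "b \<in> {b. mat_mult A B a b \<noteq> 0}"
    then have "(\<Sum>c | A a c \<noteq> 0. A a c * B c b) \<noteq> 0"
      by (simp add: mat_mult_def)
    then obtain c where "c \<in> {c. A a c \<noteq> 0}" "A a c * B c b \<noteq> 0"
      by (rule sum.not_neutral_contains_not_neutral)
    then show "b \<in> (\<Union>c\<in>{c. A a c \<noteq> 0}. {b. B c b \<noteq> 0})" by auto
  qed
  then show "finite {b. mat_mult A B a b \<noteq> 0}"
    by (rule finite_subset) (use assms in \<open>auto simp: row_finite_def\<close>)
qed

text \<open>For matrices with infinitely many rows this is an exchange of two sums, which are finite because
  the rows of \<open>A\<close> and \<open>B\<close> are.\<close>

lemma mat_mult_assoc:
  assumes "row_finite A" "row_finite B"
  shows "mat_mult (mat_mult A B) C = mat_mult A (mat_mult B C)"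
proof (intro ext)
  fix a b
  define S where "S = {c. A a c \<noteq> 0}"
  define T where "T = (\<Union>c\<in>S. {d. B c d \<noteq> 0})"
  have fin: "finite S" "finite T" using assms by (auto simp: S_def T_def row_finite_def)
  have AB: "mat_mult A B a d = (\<Sum>c\<in>S. A a c * B c d)" for d
    by (simp add: mat_mult_def S_def)
  have "mat_mult (mat_mult A B) C a b = (\<Sum>d\<in>T. (\<Sum>c\<in>S. A a c * B c d) * C d b)"
    unfolding AB[symmetric]
    by (rule mat_mult_eq_sum[OF fin(2)]) (auto simp: AB T_def intro!: sum.neutral)
  also have "\<dots> = (\<Sum>c\<in>S. \<Sum>d\<in>T. A a c * (B c d * C d b))"
    by (subst sum.swap) (simp add: sum_distrib_right mult.assoc)
  also have "\<dots> = (\<Sum>c\<in>S. A a c * mat_mult B C c b)"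
    by (rule sum.cong[OF refl])
      (subst mat_mult_eq_sum[OF fin(2), of B], auto simp: T_def sum_distrib_left)
  also have "\<dots> = mat_mult A (mat_mult B C) a b"
    by (simp add: mat_mult_def S_def)
  finally show "mat_mult (mat_mult A B) C a b = mat_mult A (mat_mult B C) a b" .
qed

lemma mat_mult_unit_column:
  assumes "row_finite A" "\<And>c. B c b = mat_one c b"
  shows "mat_mult A B a b = A a b"
proof -
  have "mat_mult A B a b = (\<Sum>c\<in>{c. A a c \<noteq> 0}. if c = b then A a c else 0)"
    unfolding mat_mult_def by (rule sum.cong) (auto simp: assms(2) mat_one_def)
  also have "\<dots> = A a b"
    using assms(1) by (simp add: row_finite_def sum.delta)
  finally show ?thesis .
qed

lemma mat_mult_unit_row:
  assumes "\<And>c. A a c = mat_one a c"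
  shows "mat_mult A B a b = B a b"
  by (subst mat_mult_eq_sum[of "{a}"]) (auto simp: assms mat_one_def)

lemma mat_mult_one_left [simp]: "mat_mult mat_one A = A"
  by (intro ext mat_mult_unit_row) simp

lemma mat_mult_one_right [simp]: "row_finite A \<Longrightarrow> mat_mult A mat_one = A"
  by (intro ext mat_mult_unit_column) simp_all

section \<open>Matrices that differ from the identity in a set of indices\<close>

definition supported_on :: "'i set \<Rightarrow> 'i qmat \<Rightarrow> bool"
  where "supported_on S A \<longleftrightarrow> (\<forall>a b. a \<in> S \<and> b \<in> S \<or> A a b = mat_one a b)"

lemma supported_onI:
  "(\<And>a b. a \<notin> S \<or> b \<notin> S \<Longrightarrow> A a b = mat_one a b) \<Longrightarrow> supported_on S A"
  unfolding supported_on_def by blast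

lemma supported_onD: "supported_on S A \<Longrightarrow> a \<notin> S \<or> b \<notin> S \<Longrightarrow> A a b = mat_one a b"
  by (auto simp: supported_on_def)

lemma supported_on_mono: "supported_on S A \<Longrightarrow> S \<subseteq> T \<Longrightarrow> supported_on T A"
  by (auto simp: supported_on_def)

lemma supported_on_one [simp]: "supported_on S mat_one"
  by (simp add: supported_on_def)

lemma supported_on_zero: "supported_on S A \<Longrightarrow> c \<notin> S \<Longrightarrow> c \<noteq> a \<Longrightarrow> A a c = 0"
  and supported_on_zero': "supported_on S A \<Longrightarrow> c \<notin> S \<Longrightarrow> c \<noteq> a \<Longrightarrow> A c a = 0"
  by (simp_all add: supported_onD mat_one_def)

lemma supported_on_row_finite:
  assumes "supported_on S A" "finite S"
  shows "row_finite A"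
  unfolding row_finite_def
proof
  fix a
  have "{c. A a c \<noteq> 0} \<subseteq> insert a S" using supported_on_zero[OF assms(1)] by blast
  then show "finite {c. A a c \<noteq> 0}" using assms(2) by (meson finite.insertI finite_subset)
qed

lemma supported_on_transposed:
  assumes "supported_on S A" "c 0 = 0" "c 1 = 1"
  shows "supported_on S (\<lambda>a b. c (A b a))"
  unfolding supported_on_def
proof (intro allI)
  fix a b
  show "a \<in> S \<and> b \<in> S \<or> c (A b a) = mat_one a b"
  proof (cases "a \<in> S \<and> b \<in> S")
    case False
    then have "A b a = mat_one b a" by (intro supported_onD[OF assms(1)]) auto
    then show ?thesis using assms(2,3) by (simp add: mat_one_def)
  qed simp
qed

lemma supported_on_mult:
  assumes "supported_on S A" "supported_on S B" "row_finite A"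
  shows "supported_on S (mat_mult A B)"
  unfolding supported_on_def
proof (intro allI)
  fix a b
  show "a \<in> S \<and> b \<in> S \<or> mat_mult A B a b = mat_one a b"
  proof (cases "a \<in> S \<and> b \<in> S")
    case False
    then consider "a \<notin> S" | "b \<notin> S" by blast
    then have "mat_mult A B a b = mat_one a b"
    proof cases
      case 1
      then have "mat_mult A B a b = B a b"
        by (intro mat_mult_unit_row supported_onD[OF assms(1)]) simp
      with 1 show ?thesis by (simp add: supported_onD[OF assms(2)])
    next
      case 2
      then have "mat_mult A B a b = A a b"
        by (intro mat_mult_unit_column assms(3) supported_onD[OF assms(2)]) simp
      with 2 show ?thesis by (simp add: supported_onD[OF assms(1)])
    qed
    then show ?thesis by simp
  qed simp
qed

text \<open>The source of all commutation in this theory: either product has the rows of \<open>A\<close> over \<open>S\<close> and the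
  rows of \<open>B\<close> elsewhere.\<close>

lemma supported_on_commute:
  assumes A: "supported_on S A" "row_finite A" and B: "supported_on (- S) B" "row_finite B"
  shows "mat_mult A B = mat_mult B A"
proof (intro ext)
  fix a b
  note zero = supported_on_zero[OF A(1)] supported_on_zero[OF B(1)]
  show "mat_mult A B a b = mat_mult B A a b"
  proof (cases "a \<in> S")
    case True
    have "B c b = mat_one c b" if "A a c \<noteq> 0" for c
      using supported_onD[OF B(1)] zero(1)[of c a] True that by auto
    then have "mat_mult A B a b = mat_mult A mat_one a b"
      unfolding mat_mult_def by (intro sum.cong) auto
    also have "\<dots> = A a b" using A(2) by simp
    also have "\<dots> = mat_mult B A a b"
      using True by (intro mat_mult_unit_row[symmetric] supported_onD[OF B(1)]) simp
    finally show ?thesis .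
  next
    case False
    have "A c b = mat_one c b" if "B a c \<noteq> 0" for c
      using supported_onD[OF A(1)] zero(2)[of c a] False that by auto
    then have "mat_mult B A a b = mat_mult B mat_one a b"
      unfolding mat_mult_def by (intro sum.cong) auto
    also have "\<dots> = B a b" using B(2) by simp
    also have "\<dots> = mat_mult A B a b"
      using False by (intro mat_mult_unit_row[symmetric] supported_onD[OF A(1)]) simp
    finally show ?thesis by simp
  qed
qed

section \<open>Groups of finite matrices\<close>

lemma carrier_finite_matrices:
  "A \<in> carrier (finite_matrices I F) \<longleftrightarrow>
    (\<forall>a b. A a b \<in> scalar_set F) \<and> (\<exists>S. finite S \<and> S \<subseteq> I \<and> supported_on S A)"
proof -
  let ?D = "{(a, b). A a b \<noteq> mat_one a b}"
  have "finite ?D \<and> ?D \<subseteq> I \<times> I \<longleftrightarrow> (\<exists>S. finite S \<and> S \<subseteq> I \<and> supported_on S A)"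
  proof (intro iffI; (elim exE)?)
    assume D: "finite ?D \<and> ?D \<subseteq> I \<times> I"
    then have "finite (fst ` ?D \<union> snd ` ?D)" "fst ` ?D \<union> snd ` ?D \<subseteq> I" by auto
    moreover have "supported_on (fst ` ?D \<union> snd ` ?D) A"
      unfolding supported_on_def by (force simp: image_iff)
    ultimately show "\<exists>S. finite S \<and> S \<subseteq> I \<and> supported_on S A" by blast
  next
    fix S assume S: "finite S \<and> S \<subseteq> I \<and> supported_on S A"
    then have "?D \<subseteq> S \<times> S" by (auto simp: supported_on_def)
    then show "finite ?D \<and> ?D \<subseteq> I \<times> I"
      using S by (auto intro: finite_subset[of _ "S \<times> S"])
  qed
  then show ?thesis by (simp add: finite_matrices_def)
qed

lemma finite_matrices_simps [simp]:
  "\<one>\<^bsub>finite_matrices I F\<^esub> = mat_one" "A \<otimes>\<^bsub>finite_matrices I F\<^esub> B = mat_mult A B"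
  by (simp_all add: finite_matrices_def)

lemma finite_matrices_entry: "A \<in> carrier (finite_matrices I F) \<Longrightarrow> A a b \<in> scalar_set F"
  by (simp add: carrier_finite_matrices)

lemma finite_matrices_support:
  assumes "A \<in> carrier (finite_matrices I F)"
  obtains S where "finite S" "S \<subseteq> I" "supported_on S A"
  using assms by (auto simp: carrier_finite_matrices)

lemma finite_matrices_row_finite: "A \<in> carrier (finite_matrices I F) \<Longrightarrow> row_finite A"
  by (auto elim: finite_matrices_support intro: supported_on_row_finite)

lemma finite_matrices_mult:
  assumes A: "A \<in> carrier (finite_matrices I F)" and B: "B \<in> carrier (finite_matrices I F)"
  shows "mat_mult A B \<in> carrier (finite_matrices I F)"
proof -
  obtain S T where "finite S" "S \<subseteq> I" "supported_on S A" "finite T" "T \<subseteq> I" "supported_on T B"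
    using A B by (auto elim!: finite_matrices_support)
  then have "finite (S \<union> T)" "S \<union> T \<subseteq> I" "supported_on (S \<union> T) (mat_mult A B)"
    using finite_matrices_row_finite[OF A]
    by (auto intro!: supported_on_mult elim: supported_on_mono)
  moreover have "mat_mult A B a b \<in> scalar_set F" for a b
    unfolding mat_mult_def
    by (intro scalar_set_sum scalar_set_mult finite_matrices_entry[OF A] finite_matrices_entry[OF B])
  ultimately show ?thesis unfolding carrier_finite_matrices by blast
qed

lemma monoid_finite_matrices: "monoid (finite_matrices I F)"
proof (rule monoidI, unfold finite_matrices_simps)
  show "mat_one \<in> carrier (finite_matrices I F)"
    by (auto simp: carrier_finite_matrices mat_one_def[of a b for a b] intro!: exI[of _ "{}"])
qed (auto simp: finite_matrices_mult mat_mult_assoc finite_matrices_row_finite)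

text \<open>The isometries of a form \<open>J\<close> with respect to the transpose twisted by \<open>c\<close>. Conjugation as \<open>c\<close>
  gives the groups that preserve (skew-)Hermitian forms, the identity as \<open>c\<close> those that preserve
  bilinear ones.\<close>

definition isometries :: "'i set \<Rightarrow> scalars \<Rightarrow> (quat \<Rightarrow> quat) \<Rightarrow> 'i qmat \<Rightarrow> 'i qmat set"
  where "isometries I F c J =
    {A \<in> Units (finite_matrices I F). mat_mult (mat_mult (\<lambda>a b. c (A b a)) J) A = J}"

text \<open>The twisted transpose reverses products only if \<open>c\<close> does. For \<open>c\<close> the identity this confines the
  bilinear groups to commutative scalars, whence the restriction to \<^term>\<open>scalar_set F\<close>.\<close>

lemma mat_mult_transposed:
  assumes c: "c 0 = 0" "\<And>x y. c (x + y) = c x + c y"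
    "\<And>x y. x \<in> scalar_set F \<Longrightarrow> y \<in> scalar_set F \<Longrightarrow> c (x * y) = c y * c x"
    and A: "A \<in> carrier (finite_matrices I F)" and B: "B \<in> carrier (finite_matrices I F)"
  shows "(\<lambda>a b. c (mat_mult A B b a)) = mat_mult (\<lambda>a b. c (B b a)) (\<lambda>a b. c (A b a))"
proof (intro ext)
  fix a b
  obtain S T where S: "finite S" "supported_on S A" and T: "finite T" "supported_on T B"
    using A B by (auto elim!: finite_matrices_support)
  let ?U = "insert a (insert b (S \<union> T))"
  have c_sum: "c (sum h U) = (\<Sum>x\<in>U. c (h x))" for h :: "'a \<Rightarrow> quat" and U
    by (induction U rule: infinite_finite_induct) (auto simp: c)
  have AS: "A b d = 0" if "d \<notin> ?U" for d
    using that by (intro supported_on_zero[OF S(2)]) auto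
  have BT: "B d a = 0" if "d \<notin> ?U" for d
    using that by (intro supported_on_zero'[OF T(2)]) auto
  have "c (mat_mult A B b a) = (\<Sum>d\<in>?U. c (B d a) * c (A b d))"
    using S(1) T(1) AS
    by (subst mat_mult_eq_sum[of ?U])
      (auto simp del: sum.insert simp: c_sum intro!: sum.cong c(3) finite_matrices_entry[OF A] finite_matrices_entry[OF B])
  also have "\<dots> = mat_mult (\<lambda>a b. c (B b a)) (\<lambda>a b. c (A b a)) a b"
    using S(1) T(1) BT
    by (subst mat_mult_eq_sum[of ?U]) (auto simp: c simp del: sum.insert)
  finally show "c (mat_mult A B b a) = mat_mult (\<lambda>a b. c (B b a)) (\<lambda>a b. c (A b a)) a b" .
qed

lemma subgroup_isometries:
  assumes c: "c 0 = 0" "c 1 = 1" "\<And>x y. c (x + y) = c x + c y"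
    "\<And>x y. x \<in> scalar_set F \<Longrightarrow> y \<in> scalar_set F \<Longrightarrow> c (x * y) = c y * c x"
    and J: "row_finite J"
  shows "subgroup (isometries I F c J) (units_of (finite_matrices I F))"
proof -
  interpret M: monoid "finite_matrices I F" by (rule monoid_finite_matrices)
  interpret U: group "units_of (finite_matrices I F)" by (rule M.units_group)
  define s where "s A = (\<lambda>a b. c (A b a))" for A :: "'a qmat"
  note U_simps = units_of_carrier units_of_mult units_of_one finite_matrices_simps
  have rf: "row_finite A" "row_finite (s A)" if A: "A \<in> carrier (finite_matrices I F)" for A
  proof -
    show "row_finite A" using A by (rule finite_matrices_row_finite)
    obtain S where "finite S" "supported_on S A"
      using A by (rule finite_matrices_support)
    then have "finite S" "supported_on S (s A)"
      using c(1,2) by (auto simp: s_def intro: supported_on_transposed)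
    then show "row_finite (s A)" by (rule supported_on_row_finite[rotated])
  qed
  have s_mult: "s (mat_mult A B) = mat_mult (s B) (s A)"
    if "A \<in> Units (finite_matrices I F)" "B \<in> Units (finite_matrices I F)" for A B
    unfolding s_def using c that by (intro mat_mult_transposed) auto
  have iso: "A \<in> isometries I F c J \<longleftrightarrow>
      A \<in> Units (finite_matrices I F) \<and> mat_mult (mat_mult (s A) J) A = J" for A
    by (simp add: isometries_def s_def)
  have s_one: "s mat_one = mat_one"
    using c(1,2) by (intro ext) (auto simp: s_def mat_one_def)
  note assoc = mat_mult_assoc row_finite_mult rf J M.Units_closed
  have mult: "mat_mult A B \<in> isometries I F c J"
    if A: "A \<in> isometries I F c J" and B: "B \<in> isometries I F c J" for A B
  proof -
    have AB: "A \<in> Units (finite_matrices I F)" "B \<in> Units (finite_matrices I F)"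
      using A B by (simp_all add: iso)
    have "mat_mult (mat_mult (s (mat_mult A B)) J) (mat_mult A B)
      = mat_mult (mat_mult (s B) (mat_mult (mat_mult (s A) J) A)) B"
      using AB by (simp add: s_mult assoc)
    also have "\<dots> = J" using A B by (simp add: iso)
    finally show ?thesis
      using A B M.Units_m_closed[of A B] by (simp add: iso)
  qed
  have inv: "inv\<^bsub>units_of (finite_matrices I F)\<^esub> A \<in> isometries I F c J"
    if A: "A \<in> isometries I F c J" for A
  proof -
    define B where "B = inv\<^bsub>finite_matrices I F\<^esub> A"
    have AU: "A \<in> Units (finite_matrices I F)" using A by (simp add: iso)
    then have B: "B \<in> Units (finite_matrices I F)" and AB: "mat_mult A B = mat_one"
      using M.Units_r_inv[OF AU] by (simp_all add: B_def)
    have "mat_mult (mat_mult (s B) J) B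
      = mat_mult (mat_mult (s B) (mat_mult (mat_mult (s A) J) A)) B"
      using A by (simp add: iso)
    also have "\<dots> = mat_mult (mat_mult (mat_mult (s B) (s A)) J) (mat_mult A B)"
      using AU B by (simp add: assoc)
    also have "\<dots> = J"
      using AU B J by (simp add: AB s_one flip: s_mult)
    finally show ?thesis
      using AU B by (simp add: iso M.units_of_inv flip: B_def)
  qed
  show ?thesis
  proof (rule U.subgroupI)
    show "isometries I F c J \<subseteq> carrier (units_of (finite_matrices I F))"
      by (auto simp: iso U_simps)
    have "mat_one \<in> isometries I F c J"
      using M.Units_one_closed s_one J by (simp add: iso)
    then show "isometries I F c J \<noteq> {}" by auto
  qed (use mult inv in \<open>auto simp: U_simps\<close>)
qed

lemma matrix_group_simps:
  "\<one>\<^bsub>matrix_group I F P\<^esub> = mat_one"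
  "A \<otimes>\<^bsub>matrix_group I F P\<^esub> B = mat_mult A B"
  "carrier (matrix_group I F P) = {A \<in> Units (finite_matrices I F). P A}"
  by (simp_all add: matrix_group_def units_of_def)

lemma group_matrix_group:
  assumes "c 0 = 0" "c 1 = 1" "\<And>x y. c (x + y) = c x + c y"
    "\<And>x y. x \<in> scalar_set F \<Longrightarrow> y \<in> scalar_set F \<Longrightarrow> c (x * y) = c y * c x"
    and "row_finite J"
    and P: "\<And>A. A \<in> carrier (finite_matrices I F) \<Longrightarrow>
      P A \<longleftrightarrow> mat_mult (mat_mult (\<lambda>a b. c (A b a)) J) A = J"
  shows "group (matrix_group I F P)"
proof -
  interpret M: monoid "finite_matrices I F" by (rule monoid_finite_matrices)
  have "{A \<in> Units (finite_matrices I F). P A} = isometries I F c J"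
    using P M.Units_closed by (auto simp: isometries_def)
  then show ?thesis
    using subgroup.subgroup_is_group[OF subgroup_isometries M.units_group] assms(1-5)
    by (simp add: matrix_group_def)
qed

lemma row_finite_adj: "A \<in> carrier (finite_matrices I F) \<Longrightarrow> row_finite (adj A)"
proof (elim finite_matrices_support)
  fix S assume "finite S" "supported_on S A"
  then show "row_finite (adj A)"
    using supported_on_row_finite[OF supported_on_transposed[of S A quat_cnj]]
    by (simp add: adj_def[abs_def])
qed

lemma row_finite_transp: "A \<in> carrier (finite_matrices I F) \<Longrightarrow> row_finite (transp A)"
proof (elim finite_matrices_support)
  fix S assume "finite S" "supported_on S A"
  then show "row_finite (transp A)"
    using supported_on_row_finite[OF supported_on_transposed[of S A "\<lambda>x. x"]]
    by (simp add: transp_def[abs_def])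
qed

lemma group_isometries_adj:
  assumes "row_finite J"
    and "\<And>A. A \<in> carrier (finite_matrices I F) \<Longrightarrow> P A \<longleftrightarrow> mat_mult (mat_mult (adj A) J) A = J"
  shows "group (matrix_group I F P)"
  by (rule group_matrix_group[of quat_cnj _ J])
    (use assms in \<open>simp_all add: quat_cnj_add quat_cnj_mult adj_def[abs_def]\<close>)

lemma group_isometries_transp:
  assumes "row_finite J" "F \<noteq> HH"
    and "\<And>A. A \<in> carrier (finite_matrices I F) \<Longrightarrow> P A \<longleftrightarrow> mat_mult (mat_mult (transp A) J) A = J"
  shows "group (matrix_group I F P)"
  by (rule group_matrix_group[of "\<lambda>x. x" _ J])
    (use assms in \<open>simp_all add: scalar_set_commute transp_def[abs_def]\<close>)

lemma group_irr_heavy: "group (irr_heavy F)"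
  unfolding irr_heavy_def
  by (rule group_isometries_adj[of mat_one]) (simp_all add: row_finite_adj)

lemma group_all_invertible: "group (matrix_group I F (\<lambda>_. True))"
  using monoid.units_group[OF monoid_finite_matrices]
  by (simp add: matrix_group_def flip: units_of_carrier)

lemma row_finite_blocks:
  assumes "row_finite A" "row_finite B" "row_finite C" "row_finite D"
  shows "row_finite (blocks A B C D)"
  unfolding row_finite_def
proof
  fix a
  have "finite {c. blocks A B C D a (Inl c) \<noteq> 0}" "finite {c. blocks A B C D a (Inr c) \<noteq> 0}"
    using assms by (cases a; simp add: row_finite_def)+
  moreover have "{c. blocks A B C D a c \<noteq> 0} \<subseteq>
      Inl ` {c. blocks A B C D a (Inl c) \<noteq> 0} \<union> Inr ` {c. blocks A B C D a (Inr c) \<noteq> 0}"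
  proof
    fix c assume "c \<in> {c. blocks A B C D a c \<noteq> 0}"
    then show "c \<in> Inl ` {c. blocks A B C D a (Inl c) \<noteq> 0} \<union> Inr ` {c. blocks A B C D a (Inr c) \<noteq> 0}"
      by (cases c) simp_all
  qed
  ultimately show "finite {c. blocks A B C D a c \<noteq> 0}" by (auto elim: finite_subset)
qed

lemma row_finite_uminus: "row_finite A \<Longrightarrow> row_finite (\<lambda>a b. - A a b)"
  by (simp add: row_finite_def)

lemma row_finite_zero [simp]: "row_finite mat_zero"
  by (simp add: row_finite_def)

lemma row_finite_hermitian: "row_finite hermitian_form"
  and row_finite_symplectic: "row_finite symplectic_form"
  by (simp_all add: hermitian_form_def symplectic_form_def row_finite_blocks row_finite_uminus)

lemma row_finite_skew_hermitian: "row_finite skew_hermitian_form"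
  by (simp add: row_finite_def skew_hermitian_form_def)

lemma group_irr_classical: "group (irr_classical_group c)"
proof (cases c)
  case (GL_inf F)
  then have "identity c = (\<lambda>_. True)" by auto
  then show ?thesis
    by (simp add: irr_classical_group_def group_all_invertible)
next
  case (U_inf_inf F)
  then show ?thesis unfolding irr_classical_group_def
    by (intro group_isometries_adj[of hermitian_form]) (simp_all add: row_finite_hermitian)
next
  case (U_fin_inf F p)
  then show ?thesis unfolding irr_classical_group_def
    by (intro group_isometries_adj[of hermitian_form]) (simp_all add: row_finite_hermitian)
next
  case Sp_R
  then show ?thesis unfolding irr_classical_group_def
    by (intro group_isometries_transp[of symplectic_form]) (simp_all add: row_finite_symplectic)
next
  case Sp_C
  then show ?thesis unfolding irr_classical_group_def
    by (intro group_isometries_transp[of symplectic_form]) (simp_all add: row_finite_symplectic)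
next
  case O_C
  then show ?thesis unfolding irr_classical_group_def
    by (intro group_isometries_transp[of mat_one]) (simp_all add: row_finite_transp)
next
  case SO_star
  then show ?thesis unfolding irr_classical_group_def
    by (intro group_isometries_adj[of skew_hermitian_form])
      (simp_all add: row_finite_skew_hermitian)
qed

section \<open>Permutation matrices and heavy groups\<close>

definition perm_mat :: "(nat \<Rightarrow> nat) \<Rightarrow> nat qmat"
  where "perm_mat q a b = (if a = q b then 1 else 0)"

definition finite_involution :: "(nat \<Rightarrow> nat) \<Rightarrow> bool"
  where "finite_involution q \<longleftrightarrow> (\<forall>n. q (q n) = n) \<and> (\<exists>N. \<forall>n\<ge>N. q n = n)"

lemma finite_involution_eq_iff: "finite_involution q \<Longrightarrow> a = q b \<longleftrightarrow> q a = b"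
  by (auto simp: finite_involution_def)

lemma perm_mat_mult_right:
  assumes "row_finite A"
  shows "mat_mult A (perm_mat q) a b = A a (q b)"
proof -
  have "mat_mult A (perm_mat q) a b = (\<Sum>c\<in>{c. A a c \<noteq> 0}. if c = q b then A a c else 0)"
    unfolding mat_mult_def by (rule sum.cong) (auto simp: perm_mat_def)
  also have "\<dots> = A a (q b)"
    using assms by (simp add: row_finite_def)
  finally show ?thesis .
qed

lemma perm_mat_mult_left:
  assumes "finite_involution q"
  shows "mat_mult (perm_mat q) A a b = A (q a) b"
  by (subst mat_mult_eq_sum[of "{q a}"])
    (use finite_involution_eq_iff[OF assms, of a] in \<open>auto simp: perm_mat_def\<close>)

lemma perm_mat_square:
  assumes q: "finite_involution q"
  shows "mat_mult (perm_mat q) (perm_mat q) = mat_one"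
proof (intro ext)
  fix a b
  have "q a = q b \<longleftrightarrow> a = b" using q by (auto simp: finite_involution_def) metis
  then show "mat_mult (perm_mat q) (perm_mat q) a b = mat_one a b"
    by (simp add: perm_mat_mult_left[OF q] perm_mat_def mat_one_def)
qed

lemma perm_mat_in_irr_heavy:
  assumes q: "finite_involution q"
  shows "perm_mat q \<in> carrier (irr_heavy F)"
proof -
  obtain N where N: "\<And>n. n \<ge> N \<Longrightarrow> q n = n" and qq: "\<And>n. q (q n) = n"
    using q by (auto simp: finite_involution_def)
  have qN: "q n < N" if "n < N" for n
    using N[of "q n"] qq[of n] that by (cases "q n < N") auto
  have "supported_on {..<N} (perm_mat q)"
    unfolding supported_on_def
  proof (intro allI)
    fix a b
    show "a \<in> {..<N} \<and> b \<in> {..<N} \<or> perm_mat q a b = mat_one a b"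
      using N[of a] N[of b] qN[of a] qN[of b] finite_involution_eq_iff[OF q, of a b]
      by (cases "a < N"; cases "b < N") (auto simp: perm_mat_def mat_one_def)
  qed
  then have fin: "perm_mat q \<in> carrier (finite_matrices UNIV F)"
    unfolding carrier_finite_matrices by (auto simp: perm_mat_def)
  have inv: "mat_mult (perm_mat q) (perm_mat q) = mat_one"
    by (rule perm_mat_square[OF q])
  have adj: "adj (perm_mat q) = perm_mat q"
    by (intro ext) (use finite_involution_eq_iff[OF q] in \<open>auto simp: adj_def perm_mat_def\<close>)
  show ?thesis
    using fin inv by (auto simp: irr_heavy_def matrix_group_simps adj Units_def)
qed

lemma perm_mat_row_finite:
  assumes "finite_involution q"
  shows "row_finite (perm_mat q)"
  unfolding row_finite_def
proof
  fix a
  have "{c. perm_mat q a c \<noteq> 0} \<subseteq> {q a}"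
    using finite_involution_eq_iff[OF assms, of a] by (auto simp: perm_mat_def)
  then show "finite {c. perm_mat q a c \<noteq> 0}" by (rule finite_subset) simp
qed

text \<open>Exchanges the intervals \<open>{a..<a + k}\<close> and \<open>{b..<b + k}\<close>. All permutations needed below are of this
  form, including \<open>\<Theta>\<close> itself.\<close>

definition swap_intervals :: "nat \<Rightarrow> nat \<Rightarrow> nat \<Rightarrow> nat \<Rightarrow> nat"
  where "swap_intervals a b k n =
    (if a \<le> n \<and> n < a + k then n - a + b else if b \<le> n \<and> n < b + k then n - b + a else n)"

lemma finite_involution_swap_intervals:
  assumes "a + k \<le> b"
  shows "finite_involution (swap_intervals a b k)"
  unfolding finite_involution_def
proof (intro conjI allI exI[of _ "b + k"] impI)
  show "swap_intervals a b k (swap_intervals a b k n) = n" for n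
    using assms by (auto simp: swap_intervals_def)
  show "swap_intervals a b k n = n" if "b + k \<le> n" for n
    using assms that by (auto simp: swap_intervals_def)
qed

lemma Theta1_eq_perm_mat: "Theta1 \<beta> m = perm_mat (swap_intervals \<beta> (\<beta> + m) m)"
proof (intro ext)
  fix a b
  show "Theta1 \<beta> m a b = perm_mat (swap_intervals \<beta> (\<beta> + m) m) a b"
    unfolding Theta1_def perm_mat_def swap_intervals_def by (rule if_cong) auto
qed

lemma carrier_heavy_list:
  "x \<in> carrier (heavy_list Ls) \<longleftrightarrow> x \<in> (\<Pi>\<^sub>E j\<in>{..<length Ls}. carrier (irr_heavy (Ls ! j)))"
  by (simp add: heavy_def)

lemma heavy_list_entry:
  "x \<in> carrier (heavy_list Ls) \<Longrightarrow> j < length Ls \<Longrightarrow> x j \<in> carrier (irr_heavy (Ls ! j))"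
  by (auto simp: heavy_def)

lemma irr_heavy_simps:
  "\<one>\<^bsub>irr_heavy F\<^esub> = mat_one" "A \<otimes>\<^bsub>irr_heavy F\<^esub> B = mat_mult A B"
  by (simp_all add: irr_heavy_def matrix_group_simps)

lemma heavy_list_mult:
  "j < length Ls \<Longrightarrow> (x \<otimes>\<^bsub>heavy_list Ls\<^esub> y) j = mat_mult (x j) (y j)"
  by (simp add: heavy_def irr_heavy_simps)

lemma irr_heavy_finite: "A \<in> carrier (irr_heavy F) \<Longrightarrow> A \<in> carrier (finite_matrices UNIV F)"
  by (auto simp: irr_heavy_def matrix_group_simps Units_def)

lemma irr_heavy_row_finite: "A \<in> carrier (irr_heavy F) \<Longrightarrow> row_finite A"
  by (rule finite_matrices_row_finite[OF irr_heavy_finite])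

lemma irr_heavy_adj: "A \<in> carrier (irr_heavy F) \<Longrightarrow> mat_mult (adj A) A = mat_one"
  by (simp add: irr_heavy_def matrix_group_simps)

text \<open>The stabilizers are defined by columns. By unitarity a standard column forces the
  corresponding row to be standard as well, which makes the elements of \<open>L\<^sup>\<alpha>\<close> supported on the
  remaining indices.\<close>

lemma irr_heavy_unit_row:
  assumes A: "A \<in> carrier (irr_heavy F)" and "\<And>a. A a b = mat_one a b"
  shows "A b a = mat_one b a"
proof -
  have "mat_mult (adj A) A a b = adj A a b"
    using row_finite_adj[OF irr_heavy_finite[OF A]] assms(2) by (rule mat_mult_unit_column)
  then have "quat_cnj (A b a) = mat_one a b"
    by (simp add: irr_heavy_adj[OF A] adj_def)
  then have "A b a = quat_cnj (mat_one a b)" by (metis quat_cnj_cnj)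
  then show ?thesis by (simp add: mat_one_def)
qed

lemma group_heavy_list: "group (heavy_list Ls)"
  unfolding heavy_def by (intro product_group group_irr_heavy)

lemma L_stab_supported:
  assumes x: "x \<in> L_stab Ls \<alpha>" and j: "j < length Ls"
  shows "supported_on {\<alpha> j..} (x j)"
  unfolding supported_on_def
proof (intro allI)
  fix a b
  have col: "x j a b = mat_one a b" if "b < \<alpha> j" for a b
    using x j that by (simp add: L_stab_def)
  have "x j \<in> carrier (irr_heavy (Ls ! j))"
    using x j by (auto simp: L_stab_def intro: heavy_list_entry)
  then have row: "x j a b = mat_one a b" if "a < \<alpha> j"
    by (rule irr_heavy_unit_row) (rule col[OF that])
  show "a \<in> {\<alpha> j..} \<and> b \<in> {\<alpha> j..} \<or> x j a b = mat_one a b"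
    using row col[of b a] by (cases "a < \<alpha> j"; cases "b < \<alpha> j") simp_all
qed

lemma subgroup_L_stab: "subgroup (L_stab Ls \<alpha>) (heavy_list Ls)"
proof -
  interpret L: group "heavy_list Ls" by (rule group_heavy_list)
  show ?thesis
  proof (rule L.subgroupI)
    show "L_stab Ls \<alpha> \<subseteq> carrier (heavy_list Ls)" by (auto simp: L_stab_def)
    have "\<one>\<^bsub>heavy_list Ls\<^esub> \<in> L_stab Ls \<alpha>"
      using L.one_closed by (simp add: L_stab_def) (simp add: heavy_def irr_heavy_simps)
    then show "L_stab Ls \<alpha> \<noteq> {}" by auto
  next
    fix x assume x: "x \<in> L_stab Ls \<alpha>"
    then have xL: "x \<in> carrier (heavy_list Ls)" by (simp add: L_stab_def)
    let ?y = "inv\<^bsub>heavy_list Ls\<^esub> x"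
    have "?y j a b = mat_one a b" if j: "j < length Ls" "b < \<alpha> j" for j a b
    proof -
      have "mat_mult (?y j) (x j) = (?y \<otimes>\<^bsub>heavy_list Ls\<^esub> x) j"
        using j by (simp add: heavy_list_mult)
      also have "\<dots> = mat_one"
        using j xL by (subst L.l_inv) (simp_all add: heavy_def irr_heavy_simps)
      finally have "mat_one a b = mat_mult (?y j) (x j) a b" by simp
      also have "\<dots> = ?y j a b"
        using x j xL
        by (intro mat_mult_unit_column irr_heavy_row_finite[OF heavy_list_entry])
          (auto simp: L_stab_def)
      finally show ?thesis by simp
    qed
    then show "?y \<in> L_stab Ls \<alpha>" using xL by (simp add: L_stab_def)
  next
    fix x y assume xy: "x \<in> L_stab Ls \<alpha>" "y \<in> L_stab Ls \<alpha>"
    have "mat_mult (x j) (y j) a b = mat_one a b" if "j < length Ls" "b < \<alpha> j" for j a b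
    proof -
      have "mat_mult (x j) (y j) a b = x j a b"
        using xy that
        by (intro mat_mult_unit_column irr_heavy_row_finite[OF heavy_list_entry])
          (auto simp: L_stab_def)
      then show ?thesis using xy that by (simp add: L_stab_def)
    qed
    then show "x \<otimes>\<^bsub>heavy_list Ls\<^esub> y \<in> L_stab Ls \<alpha>"
      using xy L.m_closed[of x y] by (simp add: L_stab_def heavy_list_mult)
  qed
qed

lemma L_stab_antimono:
  "(\<And>j. j < length Ls \<Longrightarrow> \<beta> j \<le> \<alpha> j) \<Longrightarrow> L_stab Ls \<alpha> \<subseteq> L_stab Ls \<beta>"
  unfolding L_stab_def using less_le_trans by blast

definition perm_elt :: "scalars list \<Rightarrow> (nat \<Rightarrow> nat \<Rightarrow> nat) \<Rightarrow> nat \<Rightarrow> nat qmat"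
  where "perm_elt Ls q = (\<lambda>j\<in>{..<length Ls}. perm_mat (q j))"

lemma perm_elt_closed:
  "(\<And>j. j < length Ls \<Longrightarrow> finite_involution (q j)) \<Longrightarrow> perm_elt Ls q \<in> carrier (heavy_list Ls)"
  by (simp add: carrier_heavy_list perm_elt_def perm_mat_in_irr_heavy)

lemma perm_elt_square:
  assumes "\<And>j. j < length Ls \<Longrightarrow> finite_involution (q j)"
  shows "perm_elt Ls q \<otimes>\<^bsub>heavy_list Ls\<^esub> perm_elt Ls q = \<one>\<^bsub>heavy_list Ls\<^esub>"
  using assms by (auto simp: heavy_def perm_elt_def irr_heavy_simps perm_mat_square)

lemma perm_elt_conj_entry:
  assumes "j < length Ls" "finite_involution (r j)" "row_finite (x j)" "row_finite (perm_mat (r j))"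
  shows "(perm_elt Ls r \<otimes>\<^bsub>heavy_list Ls\<^esub> x \<otimes>\<^bsub>heavy_list Ls\<^esub> perm_elt Ls q) j a b = x j (r j a) (q j b)"
  using assms
  by (simp add: heavy_list_mult perm_elt_def perm_mat_mult_right row_finite_mult perm_mat_mult_left)

section \<open>The involutions \<open>\<Theta>\<close>\<close>

lemma Theta_eq_perm_elt:
  "Theta Ls \<beta> m = perm_elt Ls (\<lambda>j. swap_intervals (\<beta> j) (\<beta> j + m j) (m j))"
  by (simp add: Theta_def perm_elt_def Theta1_eq_perm_mat)

lemma finite_involution_Theta: "finite_involution (swap_intervals b (b + m) m)"
  by (simp add: finite_involution_swap_intervals)

lemma Theta_closed: "Theta Ls \<beta> m \<in> carrier (heavy_list Ls)"
  unfolding Theta_eq_perm_elt by (intro perm_elt_closed finite_involution_Theta)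

lemma Theta_square: "Theta Ls \<beta> m \<otimes>\<^bsub>heavy_list Ls\<^esub> Theta Ls \<beta> m = \<one>\<^bsub>heavy_list Ls\<^esub>"
  unfolding Theta_eq_perm_elt by (intro perm_elt_square finite_involution_Theta)

lemma heavy_list_bounded_support:
  assumes x: "x \<in> carrier (heavy_list Ls)"
  obtains N where "\<And>j. j < length Ls \<Longrightarrow> supported_on {..<N} (x j)"
proof -
  have "\<exists>N. supported_on {..<N::nat} (x j)" if j: "j < length Ls" for j
  proof -
    obtain S where S: "finite S" "supported_on S (x j)"
      using irr_heavy_finite[OF heavy_list_entry[OF x j]] by (rule finite_matrices_support)
    then have "S \<subseteq> {..<Suc (Max S)}" by (auto simp: less_Suc_eq_le)
    with S show ?thesis by (blast intro: supported_on_mono)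
  qed
  then obtain N where N: "\<And>j. j < length Ls \<Longrightarrow> supported_on {..<N j} (x j)" by metis
  have "supported_on {..<\<Sum>j<length Ls. N j} (x j)" if "j < length Ls" for j
    using N[OF that] by (rule supported_on_mono) (use that in \<open>auto intro: less_le_trans member_le_sum\<close>)
  then show thesis by (rule that)
qed

text \<open>Conjugation by \<open>\<Theta>\<^sub>m\<close> relabels the indices. An index below \<open>m\<close> is either below \<open>\<beta>\<close>, where
  \<open>v\<close> and \<open>\<Theta>\<^sub>m\<close> are trivial, or is moved to an index not below \<open>m\<close>, outside the support of
  \<open>v\<close>.\<close>

lemma Theta_conj_far:
  assumes v: "v \<in> L_stab Ls \<beta>" and N: "\<And>j. j < length Ls \<Longrightarrow> supported_on {..<N} (v j)"
    and m: "\<And>j. j < length Ls \<Longrightarrow> N \<le> m j"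
  shows "Theta Ls \<beta> m \<otimes>\<^bsub>heavy_list Ls\<^esub> v \<otimes>\<^bsub>heavy_list Ls\<^esub> Theta Ls \<beta> m \<in> L_stab Ls m"
    (is "?x \<in> _")
proof -
  interpret L: group "heavy_list Ls" by (rule group_heavy_list)
  have vL: "v \<in> carrier (heavy_list Ls)" using v by (simp add: L_stab_def)
  have "?x j a b = mat_one a b" if j: "j < length Ls" and b: "b < m j" for j a b
  proof -
    let ?q = "swap_intervals (\<beta> j) (\<beta> j + m j) (m j)"
    have q: "finite_involution ?q" by (rule finite_involution_Theta)
    have "?x j a b = v j (?q a) (?q b)"
      unfolding Theta_eq_perm_elt using j q irr_heavy_row_finite[OF heavy_list_entry[OF vL j]]
      by (intro perm_elt_conj_entry perm_mat_row_finite)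
    also have "\<dots> = mat_one (?q a) (?q b)"
    proof (cases "b < \<beta> j")
      case True
      then have "?q b < \<beta> j" by (simp add: swap_intervals_def)
      then show ?thesis using v j by (simp add: L_stab_def)
    next
      case False
      then have "N \<le> ?q b" using b m[OF j] by (simp add: swap_intervals_def)
      then show ?thesis using N[OF j] by (simp add: supported_onD)
    qed
    also have "\<dots> = mat_one a b"
      using q by (auto simp: mat_one_def finite_involution_def) metis
    finally show ?thesis .
  qed
  then show ?thesis using vL Theta_closed by (simp add: L_stab_def)
qed

lemma Theta_push:
  assumes v: "v \<in> L_stab Ls \<beta>"
  shows "\<exists>N. \<forall>m. (\<forall>j<length Ls. N \<le> m j) \<longrightarrow>
    (\<exists>x\<in>L_stab Ls m. Theta Ls \<beta> m \<otimes>\<^bsub>heavy_list Ls\<^esub> v = x \<otimes>\<^bsub>heavy_list Ls\<^esub> Theta Ls \<beta> m) \<and>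
    (\<exists>y\<in>L_stab Ls m. v \<otimes>\<^bsub>heavy_list Ls\<^esub> Theta Ls \<beta> m = Theta Ls \<beta> m \<otimes>\<^bsub>heavy_list Ls\<^esub> y)"
proof -
  interpret L: group "heavy_list Ls" by (rule group_heavy_list)
  have vL: "v \<in> carrier (heavy_list Ls)" using v by (simp add: L_stab_def)
  obtain N where N: "\<And>j. j < length Ls \<Longrightarrow> supported_on {..<N} (v j)"
    using heavy_list_bounded_support[OF vL] by blast
  show ?thesis
  proof (intro exI[of _ N] allI impI)
    fix m assume m: "\<forall>j<length Ls. N \<le> m j"
    let ?T = "Theta Ls \<beta> m"
    let ?x = "?T \<otimes>\<^bsub>heavy_list Ls\<^esub> v \<otimes>\<^bsub>heavy_list Ls\<^esub> ?T"
    have "?x \<in> L_stab Ls m" using Theta_conj_far[OF v N] m by blast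
    moreover have "?T \<otimes>\<^bsub>heavy_list Ls\<^esub> v = ?x \<otimes>\<^bsub>heavy_list Ls\<^esub> ?T"
      using vL Theta_closed Theta_square[of Ls \<beta> m] by (simp add: L.m_assoc)
    moreover have "v \<otimes>\<^bsub>heavy_list Ls\<^esub> ?T = ?T \<otimes>\<^bsub>heavy_list Ls\<^esub> ?x"
      using vL Theta_closed Theta_square[of Ls \<beta> m] by (simp flip: L.m_assoc)
    ultimately show "(\<exists>x\<in>L_stab Ls m. ?T \<otimes>\<^bsub>heavy_list Ls\<^esub> v = x \<otimes>\<^bsub>heavy_list Ls\<^esub> ?T) \<and>
        (\<exists>y\<in>L_stab Ls m. v \<otimes>\<^bsub>heavy_list Ls\<^esub> ?T = ?T \<otimes>\<^bsub>heavy_list Ls\<^esub> y)" by blast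
  qed
qed

text \<open>Membership in \<open>L\<^sup>N\<close> of the products of three permutations that occur below, read off from the
  action on indices.\<close>

lemma perm_elt_triple_in_L_stab:
  assumes "\<And>j. j < length Ls \<Longrightarrow> finite_involution (q j)"
    "\<And>j. j < length Ls \<Longrightarrow> finite_involution (r j)" "\<And>j. j < length Ls \<Longrightarrow> finite_involution (s j)"
    and fixed: "\<And>j b. j < length Ls \<Longrightarrow> b < N \<Longrightarrow> q j (r j (s j b)) = b"
  shows "perm_elt Ls q \<otimes>\<^bsub>heavy_list Ls\<^esub> perm_elt Ls r \<otimes>\<^bsub>heavy_list Ls\<^esub> perm_elt Ls s
    \<in> L_stab Ls (\<lambda>_. N)" (is "?x \<in> _")
proof -
  interpret L: group "heavy_list Ls" by (rule group_heavy_list)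
  have "?x j a b = mat_one a b" if j: "j < length Ls" and b: "b < N" for j a b
  proof -
    have "?x j a b = perm_elt Ls r j (q j a) (s j b)"
      using perm_elt_conj_entry[of j Ls q "perm_elt Ls r" s a b] j assms(1,2)[OF j]
      by (simp add: perm_elt_def perm_mat_row_finite)
    also have "\<dots> = perm_mat (q j) a (r j (s j b))"
      using j finite_involution_eq_iff[OF assms(1)[OF j], of a "r j (s j b)"]
      by (simp add: perm_elt_def perm_mat_def)
    also have "\<dots> = mat_one a b"
      by (simp add: perm_mat_def mat_one_def fixed[OF j b])
    finally show ?thesis .
  qed
  then show ?thesis using perm_elt_closed[OF assms(1)] perm_elt_closed[OF assms(2)]
      perm_elt_closed[OF assms(3)] by (simp add: L_stab_def)
qed

text \<open>The witness \<open>v\<close> exchanges \<open>{\<gamma> + m..<N + m}\<close>, the image of \<open>{\<gamma>..<N}\<close> under \<open>\<Theta>\<^sub>m\<close>, with the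
  corresponding interval for \<open>m'\<close>. Therefore \<open>\<Theta>\<^bsub>m'\<^esub> v \<Theta>\<^sub>m\<close> sends an index \<open>b\<close> in \<open>{\<gamma>..<N}\<close> to \<open>b + m\<close>,
  \<open>b + m'\<close> and back to \<open>b\<close>. The interval \<open>{\<beta> + n..<N + n}\<close> lies between the two and is fixed by
  \<open>v\<close>, so conjugating \<open>v\<close> by \<open>\<Theta>\<^sub>n\<close> again gives an element that fixes the indices below \<open>N\<close>.\<close>

lemma Theta_relocate:
  assumes "\<And>j. j < length Ls \<Longrightarrow> \<gamma> j \<le> N \<and> \<beta> j \<le> N \<and> N \<le> m j \<and> m j + N \<le> n j \<and> n j + N \<le> m' j"
  shows "\<exists>u\<in>L_stab Ls (\<lambda>_. N). \<exists>v\<in>L_stab Ls (\<lambda>_. N). \<exists>w\<in>L_stab Ls (\<lambda>_. N).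
    Theta Ls \<gamma> m' = u \<otimes>\<^bsub>heavy_list Ls\<^esub> Theta Ls \<gamma> m \<otimes>\<^bsub>heavy_list Ls\<^esub> v \<and>
    v \<otimes>\<^bsub>heavy_list Ls\<^esub> Theta Ls \<beta> n = Theta Ls \<beta> n \<otimes>\<^bsub>heavy_list Ls\<^esub> w"
proof -
  interpret L: group "heavy_list Ls" by (rule group_heavy_list)
  define q where "q j = swap_intervals (\<gamma> j + m j) (\<gamma> j + m' j) (N - \<gamma> j)" for j
  define v where "v = perm_elt Ls q"
  let ?T = "Theta Ls \<gamma> m" and ?T' = "Theta Ls \<gamma> m'" and ?S = "Theta Ls \<beta> n"
  have q: "finite_involution (q j)" if "j < length Ls" for j
    unfolding q_def using assms[OF that] by (intro finite_involution_swap_intervals) linarith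
  have vL: "v \<in> carrier (heavy_list Ls)"
    unfolding v_def using q by (rule perm_elt_closed)
  have vv: "v \<otimes>\<^bsub>heavy_list Ls\<^esub> v = \<one>\<^bsub>heavy_list Ls\<^esub>"
    unfolding v_def using q by (rule perm_elt_square)
  have "v \<in> L_stab Ls (\<lambda>_. N)"
  proof -
    have "perm_mat (q j) a b = mat_one a b" if "j < length Ls" "b < N" for j a b
      using assms[OF that(1)] that(2) by (simp add: perm_mat_def mat_one_def q_def swap_intervals_def)
    then show ?thesis using vL by (simp add: L_stab_def) (simp add: v_def perm_elt_def)
  qed
  moreover have "?T' \<otimes>\<^bsub>heavy_list Ls\<^esub> v \<otimes>\<^bsub>heavy_list Ls\<^esub> ?T \<in> L_stab Ls (\<lambda>_. N)"
    unfolding v_def Theta_eq_perm_elt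
  proof (rule perm_elt_triple_in_L_stab)
    fix j b assume j: "j < length Ls" and b: "b < N"
    show "swap_intervals (\<gamma> j) (\<gamma> j + m' j) (m' j) (q j (swap_intervals (\<gamma> j) (\<gamma> j + m j) (m j) b)) = b"
    proof (cases "b < \<gamma> j")
      case True
      then have "swap_intervals (\<gamma> j) (\<gamma> j + m j) (m j) b = b" "q j b = b"
        "swap_intervals (\<gamma> j) (\<gamma> j + m' j) (m' j) b = b"
        using assms[OF j] by (simp_all add: q_def swap_intervals_def)
      then show ?thesis by simp
    next
      case False
      then have "swap_intervals (\<gamma> j) (\<gamma> j + m j) (m j) b = b + m j" "q j (b + m j) = b + m' j"
        "swap_intervals (\<gamma> j) (\<gamma> j + m' j) (m' j) (b + m' j) = b"
        using assms[OF j] b by (simp_all add: q_def swap_intervals_def)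
      then show ?thesis by simp
    qed
  qed (use q finite_involution_Theta in auto)
  moreover have "?S \<otimes>\<^bsub>heavy_list Ls\<^esub> v \<otimes>\<^bsub>heavy_list Ls\<^esub> ?S \<in> L_stab Ls (\<lambda>_. N)"
    unfolding v_def Theta_eq_perm_elt
  proof (rule perm_elt_triple_in_L_stab)
    fix j b assume j: "j < length Ls" and b: "b < N"
    show "swap_intervals (\<beta> j) (\<beta> j + n j) (n j) (q j (swap_intervals (\<beta> j) (\<beta> j + n j) (n j) b)) = b"
    proof (cases "b < \<beta> j")
      case True
      then have "swap_intervals (\<beta> j) (\<beta> j + n j) (n j) b = b" "q j b = b"
        using assms[OF j] by (simp_all add: q_def swap_intervals_def)
      then show ?thesis by simp
    next
      case False
      then have "swap_intervals (\<beta> j) (\<beta> j + n j) (n j) b = b + n j" "q j (b + n j) = b + n j"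
        "swap_intervals (\<beta> j) (\<beta> j + n j) (n j) (b + n j) = b"
        using assms[OF j] b by (simp_all add: q_def swap_intervals_def)
      then show ?thesis by simp
    qed
  qed (use q finite_involution_Theta in auto)
  moreover have "?T' = (?T' \<otimes>\<^bsub>heavy_list Ls\<^esub> v \<otimes>\<^bsub>heavy_list Ls\<^esub> ?T) \<otimes>\<^bsub>heavy_list Ls\<^esub> ?T \<otimes>\<^bsub>heavy_list Ls\<^esub> v"
  proof -
    have "(?T' \<otimes>\<^bsub>heavy_list Ls\<^esub> v \<otimes>\<^bsub>heavy_list Ls\<^esub> ?T) \<otimes>\<^bsub>heavy_list Ls\<^esub> ?T \<otimes>\<^bsub>heavy_list Ls\<^esub> v
      = ?T' \<otimes>\<^bsub>heavy_list Ls\<^esub> v \<otimes>\<^bsub>heavy_list Ls\<^esub> (?T \<otimes>\<^bsub>heavy_list Ls\<^esub> ?T) \<otimes>\<^bsub>heavy_list Ls\<^esub> v"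
      using vL Theta_closed by (simp only: L.m_assoc L.m_closed)
    also have "\<dots> = ?T' \<otimes>\<^bsub>heavy_list Ls\<^esub> (v \<otimes>\<^bsub>heavy_list Ls\<^esub> v)"
      using vL Theta_closed by (simp only: Theta_square L.m_assoc L.m_closed L.l_one L.one_closed)
    finally show ?thesis using Theta_closed by (simp only: vv L.r_one)
  qed
  moreover have "v \<otimes>\<^bsub>heavy_list Ls\<^esub> ?S = ?S \<otimes>\<^bsub>heavy_list Ls\<^esub> (?S \<otimes>\<^bsub>heavy_list Ls\<^esub> v \<otimes>\<^bsub>heavy_list Ls\<^esub> ?S)"
    using vL Theta_closed Theta_square[of Ls \<beta> n] by (simp flip: L.m_assoc)
  ultimately show ?thesis by blast
qed

section \<open>Block matrices and invariant forms\<close>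

lemma mat_mult_sum_type:
  fixes M :: "(nat + nat) qmat"
  assumes "row_finite M"
  shows "mat_mult M N x y = (\<Sum>c | M x (Inl c) \<noteq> 0. M x (Inl c) * N (Inl c) y) +
    (\<Sum>c | M x (Inr c) \<noteq> 0. M x (Inr c) * N (Inr c) y)"
proof -
  let ?S = "{c. M x (Inl c) \<noteq> 0}" and ?T = "{c. M x (Inr c) \<noteq> 0}"
  have fin: "finite {c. M x c \<noteq> 0}" using assms by (simp add: row_finite_def)
  have S: "finite ?S" and T: "finite ?T"
    using finite_vimageI[OF fin inj_Inl] finite_vimageI[OF fin inj_Inr]
    unfolding vimage_def mem_Collect_eq .
  have zero: "M x c = 0" if "c \<notin> Inl ` ?S \<union> Inr ` ?T" for c
    using that by (cases c) (simp_all add: image_iff)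
  have "mat_mult M N x y = (\<Sum>c\<in>Inl ` ?S \<union> Inr ` ?T. M x c * N c y)"
    by (intro mat_mult_eq_sum finite_UnI finite_imageI S T zero)
  also have "\<dots> = (\<Sum>c\<in>Inl ` ?S. M x c * N c y) + (\<Sum>c\<in>Inr ` ?T. M x c * N c y)"
    by (intro sum.union_disjoint finite_imageI S T) blast
  finally show ?thesis by (simp add: sum.reindex)
qed

lemma blocks_mult:
  assumes "row_finite A" "row_finite B" "row_finite C" "row_finite D"
  shows "mat_mult (blocks A B C D) (blocks A' B' C' D') = blocks
    (\<lambda>a b. mat_mult A A' a b + mat_mult B C' a b) (\<lambda>a b. mat_mult A B' a b + mat_mult B D' a b)
    (\<lambda>a b. mat_mult C A' a b + mat_mult D C' a b) (\<lambda>a b. mat_mult C B' a b + mat_mult D D' a b)"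
proof (intro ext)
  fix x y
  show "mat_mult (blocks A B C D) (blocks A' B' C' D') x y = blocks
    (\<lambda>a b. mat_mult A A' a b + mat_mult B C' a b) (\<lambda>a b. mat_mult A B' a b + mat_mult B D' a b)
    (\<lambda>a b. mat_mult C A' a b + mat_mult D C' a b) (\<lambda>a b. mat_mult C B' a b + mat_mult D D' a b) x y"
    unfolding mat_mult_sum_type[OF row_finite_blocks[OF assms]]
    by (cases x; cases y) (simp_all add: mat_mult_def)
qed

lemma mat_mult_zero [simp]: "mat_mult mat_zero A = mat_zero" "mat_mult A mat_zero = mat_zero"
  by (simp_all add: mat_mult_def[abs_def])

lemma mat_mult_uminus_left: "mat_mult (\<lambda>a b. - A a b) B = (\<lambda>a b. - mat_mult A B a b)"
  by (simp add: mat_mult_def[abs_def] sum_negf)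

lemma mat_mult_uminus_right: "mat_mult A (\<lambda>a b. - B a b) = (\<lambda>a b. - mat_mult A B a b)"
  by (simp add: mat_mult_def[abs_def] sum_negf)

lemma blocks_diag_mult:
  assumes "row_finite A" "row_finite D"
  shows "mat_mult (blocks A mat_zero mat_zero D) (blocks A' mat_zero mat_zero D') =
    blocks (mat_mult A A') mat_zero mat_zero (mat_mult D D')"
  using assms by (simp add: blocks_mult)

lemma blocks_one: "blocks mat_one mat_zero mat_zero mat_one = mat_one"
proof (intro ext)
  fix x y :: "nat + nat"
  show "blocks mat_one mat_zero mat_zero mat_one x y = mat_one x y"
    by (cases x; cases y) (simp_all add: mat_one_def)
qed

lemma adj_blocks: "adj (blocks A B C D) = blocks (adj A) (adj C) (adj B) (adj D)"
proof (intro ext)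
  fix x y
  show "adj (blocks A B C D) x y = blocks (adj A) (adj C) (adj B) (adj D) x y"
    by (cases x; cases y) (simp_all add: adj_def)
qed

lemma transp_blocks: "transp (blocks A B C D) = blocks (transp A) (transp C) (transp B) (transp D)"
proof (intro ext)
  fix x y
  show "transp (blocks A B C D) x y = blocks (transp A) (transp C) (transp B) (transp D) x y"
    by (cases x; cases y) (simp_all add: transp_def)
qed

lemma adj_zero [simp]: "adj mat_zero = mat_zero"
  and transp_zero [simp]: "transp mat_zero = mat_zero"
  and adj_one [simp]: "adj mat_one = mat_one"
  and transp_one [simp]: "transp mat_one = mat_one"
  by (intro ext; simp add: adj_def transp_def mat_one_def)+

lemma hermitian_form_preserved:
  assumes rf: "row_finite (adj A)" "row_finite (adj D)"
    and A: "mat_mult (adj A) A = mat_one" and D: "mat_mult (adj D) D = mat_one"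
  shows "mat_mult (mat_mult (adj (blocks A mat_zero mat_zero D)) hermitian_form)
    (blocks A mat_zero mat_zero D) = hermitian_form"
  using rf
  by (simp add: hermitian_form_def adj_blocks blocks_diag_mult A D row_finite_uminus
      mat_mult_uminus_left mat_mult_uminus_right)

lemma skew_hermitian_form_eq_blocks:
  "skew_hermitian_form = blocks (\<lambda>a b. if a = b then Quat 0 1 0 0 else 0) mat_zero mat_zero
    (\<lambda>a b. if a = b then Quat 0 1 0 0 else 0)"
proof (intro ext)
  fix x y
  show "skew_hermitian_form x y = blocks (\<lambda>a b. if a = b then Quat 0 1 0 0 else 0) mat_zero mat_zero
    (\<lambda>a b. if a = b then Quat 0 1 0 0 else 0) x y"
    by (cases x; cases y) (simp_all add: skew_hermitian_form_def)
qed

lemma mat_mult_scalar_left: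
  "mat_mult (\<lambda>a b. if a = b then q else 0) A = (\<lambda>a b. q * A a b)"
proof (intro ext)
  fix a b
  show "mat_mult (\<lambda>a b. if a = b then q else 0) A a b = q * A a b"
    by (subst mat_mult_eq_sum[of "{a}"]) auto
qed

lemma mat_mult_scalar_right:
  assumes "row_finite A"
  shows "mat_mult A (\<lambda>a b. if a = b then q else 0) = (\<lambda>a b. A a b * q)"
proof (intro ext)
  fix a b
  have "mat_mult A (\<lambda>a b. if a = b then q else 0) a b =
      (\<Sum>c\<in>{c. A a c \<noteq> 0}. if c = b then A a c * q else 0)"
    unfolding mat_mult_def by (rule sum.cong) auto
  also have "\<dots> = A a b * q"
    using assms by (simp add: row_finite_def)
  finally show "mat_mult A (\<lambda>a b. if a = b then q else 0) a b = A a b * q" .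
qed

text \<open>Complex matrices commute with the scalar \<open>i\<close>, so the form \<open>i\<close> can be moved to the left of the
  adjoint, and unitarity applies.\<close>

lemma skew_hermitian_form_preserved:
  assumes A: "A \<in> carrier (irr_heavy CC)"
  shows "mat_mult (mat_mult (adj (blocks mat_one mat_zero mat_zero A)) skew_hermitian_form)
    (blocks mat_one mat_zero mat_zero A) = skew_hermitian_form"
proof -
  let ?J = "\<lambda>a b :: nat. if a = b then Quat 0 1 0 0 else (0 :: quat)"
  have fin: "A \<in> carrier (finite_matrices UNIV CC)" using A by (rule irr_heavy_finite)
  have rf: "row_finite (adj A)" using fin by (rule row_finite_adj)
  have rfJ: "row_finite ?J" by (simp add: row_finite_def)
  have "mat_mult (adj A) ?J = mat_mult ?J (adj A)"
    unfolding mat_mult_scalar_left mat_mult_scalar_right[OF rf]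
    by (intro ext scalar_set_commute[of CC])
      (simp_all only: adj_def scalar_set_cnj[OF finite_matrices_entry[OF fin]],
        simp_all)
  then have "mat_mult (mat_mult (adj A) ?J) A = mat_mult ?J (mat_mult (adj A) A)"
    by (simp add: mat_mult_assoc rf rfJ)
  then have "mat_mult (mat_mult (adj A) ?J) A = ?J"
    by (simp add: irr_heavy_adj[OF A] rfJ)
  then show ?thesis
    using rf rfJ
    by (simp add: skew_hermitian_form_eq_blocks adj_blocks blocks_diag_mult row_finite_mult)
qed

text \<open>The common properties of the representations by \<open>2 \<times> 2\<close> matrices that embed \<open>U(\<infinity>)\<close> in
  \<open>Sp(2\<infinity>, \<real>)\<close> and \<open>Sp(\<infinity>)\<close> in \<open>Sp(2\<infinity>, \<complex>)\<close>. By \<open>rep_cnj\<close> the matrix of a conjugate is the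
  classical adjoint of the matrix. Indices are bounded by 2, since \<open>real_rep\<close> uses four indices and
  is multiplicative on the upper left \<open>2 \<times> 2\<close> part only for complex scalars.\<close>

locale symplectic_rep =
  fixes F :: scalars and \<rho> :: "quat \<Rightarrow> nat \<Rightarrow> nat \<Rightarrow> quat"
  assumes rep_add: "\<lbrakk>s < 2; t < 2\<rbrakk> \<Longrightarrow> \<rho> (x + y) s t = \<rho> x s t + \<rho> y s t"
    and rep_mult: "\<lbrakk>s < 2; t < 2; x \<in> scalar_set F; y \<in> scalar_set F\<rbrakk> \<Longrightarrow>
      \<rho> (x * y) s t = \<rho> x s 0 * \<rho> y 0 t + \<rho> x s 1 * \<rho> y 1 t"
    and rep_one: "\<lbrakk>s < 2; t < 2\<rbrakk> \<Longrightarrow> \<rho> 1 s t = (if s = t then 1 else 0)"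
    and rep_cnj: "x \<in> scalar_set F \<Longrightarrow> \<rho> (quat_cnj x) 0 0 = \<rho> x 1 1"
      "x \<in> scalar_set F \<Longrightarrow> \<rho> (quat_cnj x) 1 1 = \<rho> x 0 0"
      "x \<in> scalar_set F \<Longrightarrow> \<rho> (quat_cnj x) 0 1 = - \<rho> x 0 1"
      "x \<in> scalar_set F \<Longrightarrow> \<rho> (quat_cnj x) 1 0 = - \<rho> x 1 0"
begin

lemma rep_zero [simp]: "\<lbrakk>s < 2; t < 2\<rbrakk> \<Longrightarrow> \<rho> 0 s t = 0"
  using rep_add[of s t 0 0] by simp

lemma rep_sum: "\<lbrakk>s < 2; t < 2\<rbrakk> \<Longrightarrow> \<rho> (sum h S) s t = (\<Sum>c\<in>S. \<rho> (h c) s t)"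
  by (induction S rule: infinite_finite_induct) (auto simp: rep_add)

lemma row_finite_rep: "\<lbrakk>row_finite A; s < 2; t < 2\<rbrakk> \<Longrightarrow> row_finite (\<lambda>a b. \<rho> (A a b) s t)"
proof -
  assume A: "row_finite A" and "s < 2" "t < 2"
  have "{c. \<rho> (A a c) s t \<noteq> 0} \<subseteq> {c. A a c \<noteq> 0}" for a
    using \<open>s < 2\<close> \<open>t < 2\<close> by auto
  with A show "row_finite (\<lambda>a b. \<rho> (A a b) s t)"
    unfolding row_finite_def by (blast intro: finite_subset)
qed

lemma rep_mat_mult:
  assumes A: "A \<in> carrier (finite_matrices I F)" and B: "B \<in> carrier (finite_matrices I F)"
    and "s < 2" "t < 2"
  shows "\<rho> (mat_mult A B a b) s t =
    mat_mult (\<lambda>a b. \<rho> (A a b) s 0) (\<lambda>a b. \<rho> (B a b) 0 t) a b +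
    mat_mult (\<lambda>a b. \<rho> (A a b) s 1) (\<lambda>a b. \<rho> (B a b) 1 t) a b"
proof -
  have fin: "finite {c. A a c \<noteq> 0}"
    using finite_matrices_row_finite[OF A] by (simp add: row_finite_def)
  have comb: "(\<Sum>c | A a c \<noteq> 0. \<rho> (A a c) s r * \<rho> (B c b) r t) =
      mat_mult (\<lambda>a b. \<rho> (A a b) s r) (\<lambda>a b. \<rho> (B a b) r t) a b" if "r < 2" for r
    by (rule mat_mult_eq_sum[symmetric]) (use fin assms(3) that in auto)
  have "\<rho> (mat_mult A B a b) s t = (\<Sum>c | A a c \<noteq> 0. \<rho> (A a c * B c b) s t)"
    by (simp add: mat_mult_def rep_sum assms(3,4))
  also have "\<dots> = (\<Sum>c | A a c \<noteq> 0. \<rho> (A a c) s 0 * \<rho> (B c b) 0 t + \<rho> (A a c) s 1 * \<rho> (B c b) 1 t)"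
    by (intro sum.cong refl rep_mult assms(3,4) finite_matrices_entry[OF A] finite_matrices_entry[OF B])
  also have "\<dots> = (\<Sum>c | A a c \<noteq> 0. \<rho> (A a c) s 0 * \<rho> (B c b) 0 t) +
      (\<Sum>c | A a c \<noteq> 0. \<rho> (A a c) s 1 * \<rho> (B c b) 1 t)"
    by (rule sum.distrib)
  finally show ?thesis by (simp add: comb del: One_nat_def)
qed

lemma doubled_mult:
  assumes A: "A \<in> carrier (finite_matrices I F)" and B: "B \<in> carrier (finite_matrices I F)"
  shows "doubled \<rho> (mat_mult A B) = mat_mult (doubled \<rho> A) (doubled \<rho> B)"
proof -
  have "row_finite (\<lambda>a b. \<rho> (A a b) s t)" if "s < 2" "t < 2" for s t
    using _ that by (rule row_finite_rep) (rule finite_matrices_row_finite[OF A])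
  then show ?thesis
    unfolding doubled_def by (subst blocks_mult) (simp_all add: rep_mat_mult[OF A B])
qed

lemma doubled_one: "doubled \<rho> mat_one = mat_one"
proof -
  have "(\<lambda>a b. \<rho> (mat_one a b) s t) = (if s = t then mat_one else mat_zero)"
    if "s < 2" "t < 2" for s t
    using that by (intro ext) (auto simp: mat_one_def rep_one)
  then show ?thesis by (simp add: doubled_def blocks_one)
qed

lemma row_finite_doubled: "row_finite A \<Longrightarrow> row_finite (doubled \<rho> A)"
  unfolding doubled_def by (intro row_finite_blocks row_finite_rep) simp_all

text \<open>For \<open>2 \<times> 2\<close> matrices, the transpose becomes the classical adjoint when it is moved past the
  symplectic form. In terms of \<open>\<rho>\<close>, this moves \<open>transp (doubled \<rho> A)\<close> past the form as
  \<open>doubled \<rho> (adj A)\<close>, which is the inverse of \<open>doubled \<rho> A\<close> when \<open>A\<close> is unitary.\<close>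

lemma symplectic_form_preserved:
  assumes A: "A \<in> carrier (irr_heavy F)"
  shows "mat_mult (mat_mult (transp (doubled \<rho> A)) symplectic_form) (doubled \<rho> A) = symplectic_form"
proof -
  have fin: "A \<in> carrier (finite_matrices UNIV F)" using A by (rule irr_heavy_finite)
  have adj_fin: "adj A \<in> carrier (finite_matrices UNIV F)"
  proof -
    obtain S where "finite S" "supported_on S A" using fin by (rule finite_matrices_support)
    then show ?thesis
      using finite_matrices_entry[OF fin] supported_on_transposed[of S A quat_cnj]
      by (auto simp: carrier_finite_matrices adj_def[abs_def] intro: scalar_set_cnj)
  qed
  have rep_adj: "transp (\<lambda>a b. \<rho> (A a b) 0 0) = (\<lambda>a b. \<rho> (adj A a b) 1 1)"
    "transp (\<lambda>a b. \<rho> (A a b) 1 1) = (\<lambda>a b. \<rho> (adj A a b) 0 0)"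
    "transp (\<lambda>a b. \<rho> (A a b) 0 1) = (\<lambda>a b. - \<rho> (adj A a b) 0 1)"
    "transp (\<lambda>a b. \<rho> (A a b) 1 0) = (\<lambda>a b. - \<rho> (adj A a b) 1 0)"
    using rep_cnj finite_matrices_entry[OF fin]
    by (auto simp: transp_def[abs_def] adj_def)
  have "mat_mult (transp (doubled \<rho> A)) symplectic_form = mat_mult symplectic_form (doubled \<rho> (adj A))"
    unfolding doubled_def transp_blocks symplectic_form_def
    by (simp del: One_nat_def add: blocks_mult rep_adj row_finite_uminus mat_mult_uminus_left
        mat_mult_uminus_right row_finite_rep[OF row_finite_adj[OF fin]])
  then have "mat_mult (mat_mult (transp (doubled \<rho> A)) symplectic_form) (doubled \<rho> A)
      = mat_mult symplectic_form (mat_mult (doubled \<rho> (adj A)) (doubled \<rho> A))"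
    by (simp add: mat_mult_assoc row_finite_symplectic row_finite_doubled row_finite_adj[OF fin])
  also have "\<dots> = symplectic_form"
    by (simp add: irr_heavy_adj[OF A] doubled_one row_finite_symplectic
        flip: doubled_mult[OF adj_fin fin])
  finally show ?thesis .
qed

end

lemma symplectic_rep_real: "symplectic_rep CC real_rep"
  by unfold_locales
    (auto simp: real_rep_def quat_unit_def quat_defs quat_cnj_def less_2_cases_iff algebra_simps)

lemma symplectic_rep_complex: "symplectic_rep HH complex_rep"
  by unfold_locales
    (auto simp: complex_rep_def Let_def quat_defs quat_cnj_def less_2_cases_iff algebra_simps)

lemma supported_on_blocks:
  assumes "supported_on T A" "supported_on T D"
    and "\<And>a b. a \<notin> T \<or> b \<notin> T \<Longrightarrow> B a b = 0" "\<And>a b. a \<notin> T \<or> b \<notin> T \<Longrightarrow> C a b = 0"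
  shows "supported_on (Inl ` T \<union> Inr ` T) (blocks A B C D)"
proof -
  have "blocks A B C D x y = mat_one x y"
    if "x \<notin> Inl ` T \<union> Inr ` T \<or> y \<notin> Inl ` T \<union> Inr ` T" for x y
    using that assms(3,4) supported_onD[OF assms(1)] supported_onD[OF assms(2)]
    by (cases x; cases y) (simp_all add: image_iff mat_one_def)
  then show ?thesis unfolding supported_on_def by blast
qed

lemma supported_on_blocks_one:
  assumes "supported_on T D"
  shows "supported_on (Inr ` T) (blocks mat_one mat_zero mat_zero D)"
proof -
  have "blocks mat_one mat_zero mat_zero D x y = mat_one x y"
    if "x \<notin> Inr ` T \<or> y \<notin> Inr ` T" for x y
    using that supported_onD[OF assms] by (cases x; cases y) (simp_all add: image_iff mat_one_def)
  then show ?thesis unfolding supported_on_def by blast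
qed

lemma (in symplectic_rep) supported_on_doubled:
  assumes "supported_on T A"
  shows "supported_on (Inl ` T \<union> Inr ` T) (doubled \<rho> A)"
proof -
  have "\<rho> (A a b) s t = (if a = b \<and> s = t then 1 else 0)"
    if "a \<notin> T \<or> b \<notin> T" "s < 2" "t < 2" for a b s t
    using supported_onD[OF assms that(1)] that(2,3) by (simp add: mat_one_def rep_one)
  then show ?thesis
    unfolding doubled_def
    by (intro supported_on_blocks supported_onI) (simp_all add: mat_one_def)
qed

section \<open>Maximal heavy subgroups\<close>

abbreviation heavy_family :: "irr_classical \<Rightarrow> (nat \<Rightarrow> nat qmat) \<Rightarrow> bool"
  where "heavy_family c k \<equiv> \<forall>r<length (max_heavy c). k r \<in> carrier (irr_heavy (max_heavy c ! r))"

lemma max_heavy_incl_cong: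
  "(\<And>r. r < length (max_heavy c) \<Longrightarrow> k r = k' r) \<Longrightarrow> max_heavy_incl c k = max_heavy_incl c k'"
  by (cases c) simp_all

text \<open>The intersection with \<open>basis c\<close> yields membership in the group of finite matrices over the basis
  of \<open>c\<close>, and the set \<open>T\<close>, which may be infinite, yields commutation with matrices supported
  away from \<open>T\<close>.\<close>

lemma max_heavy_incl_support:
  assumes "\<And>r. r < length (max_heavy c) \<Longrightarrow> supported_on T (k r)"
  shows "supported_on (basis c \<inter> (Inl ` T \<union> Inr ` T)) (max_heavy_incl c k)"
proof -
  note one = supported_on_mono[OF supported_on_blocks_one]
  show ?thesis
  proof (cases c)
    case (U_inf_inf F)
    then show ?thesis using assms[of 0] assms[of 1] by (simp add: supported_on_blocks)
  next
    case Sp_R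
    then show ?thesis
      using assms[of 0] symplectic_rep.supported_on_doubled[OF symplectic_rep_real] by simp
  next
    case Sp_C
    then show ?thesis
      using assms[of 0] symplectic_rep.supported_on_doubled[OF symplectic_rep_complex] by simp
  qed (use assms[of 0] in \<open>auto intro!: one\<close>)
qed

lemma blocks_entry:
  assumes "\<And>a b. A a b \<in> S" "\<And>a b. B a b \<in> S" "\<And>a b. C a b \<in> S" "\<And>a b. D a b \<in> S"
  shows "blocks A B C D x y \<in> S"
  using assms by (cases x; cases y) simp_all

lemma max_heavy_incl_entry:
  assumes k: "heavy_family c k"
  shows "max_heavy_incl c k x y \<in> scalar_set (ground c)"
proof -
  have ent: "k r a b \<in> scalar_set (max_heavy c ! r)" if "r < length (max_heavy c)" for r a b
    using k that by (auto intro: finite_matrices_entry[OF irr_heavy_finite])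
  have one: "mat_one a b \<in> scalar_set F" for F and a b :: nat
    by (simp add: mat_one_def)
  show ?thesis
  proof (cases c)
    case (GL_inf F)
    show ?thesis unfolding GL_inf max_heavy_incl.simps
      by (rule blocks_entry) (use ent[of 0] one GL_inf in simp_all)
  next
    case (U_inf_inf F)
    show ?thesis unfolding U_inf_inf max_heavy_incl.simps
      by (rule blocks_entry) (use ent[of 0] ent[of 1] U_inf_inf in simp_all)
  next
    case (U_fin_inf F p)
    show ?thesis unfolding U_fin_inf max_heavy_incl.simps
      by (rule blocks_entry) (use ent[of 0] one U_fin_inf in simp_all)
  next
    case Sp_R
    show ?thesis unfolding Sp_R max_heavy_incl.simps doubled_def
      by (rule blocks_entry) (simp_all add: real_rep_def)
  next
    case Sp_C
    show ?thesis unfolding Sp_C max_heavy_incl.simps doubled_def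
      by (rule blocks_entry) (simp_all add: complex_rep_def Let_def quat_defs quat_cnj_def)
  next
    case O_C
    show ?thesis unfolding O_C max_heavy_incl.simps
      by (rule blocks_entry) (use ent[of 0] O_C in \<open>simp_all add: mat_one_def quat_defs\<close>)
  next
    case SO_star
    then show ?thesis by simp
  qed
qed

lemma max_heavy_incl_one: "max_heavy_incl c (\<lambda>_. mat_one) = mat_one"
  using symplectic_rep.doubled_one[OF symplectic_rep_real]
    symplectic_rep.doubled_one[OF symplectic_rep_complex]
  by (cases c) (simp_all add: blocks_one)

lemma max_heavy_incl_mult:
  assumes k: "heavy_family c k" and k': "heavy_family c k'"
  shows "max_heavy_incl c (\<lambda>r. mat_mult (k r) (k' r)) =
    mat_mult (max_heavy_incl c k) (max_heavy_incl c k')"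
proof -
  have fin: "k r \<in> carrier (finite_matrices UNIV (max_heavy c ! r))"
    "k' r \<in> carrier (finite_matrices UNIV (max_heavy c ! r))" if "r < length (max_heavy c)" for r
    using k k' that by (auto intro: irr_heavy_finite)
  then have rf: "row_finite (k r)" if "r < length (max_heavy c)" for r
    using that by (blast intro: finite_matrices_row_finite)
  show ?thesis
  proof (cases c)
    case Sp_R
    then show ?thesis
      using fin[of 0] symplectic_rep.doubled_mult[OF symplectic_rep_real] by simp
  next
    case Sp_C
    then show ?thesis
      using fin[of 0] symplectic_rep.doubled_mult[OF symplectic_rep_complex] by simp
  next
    case (U_inf_inf F)
    then show ?thesis using rf[of 0] rf[of 1] by (simp add: blocks_diag_mult)
  qed (use rf[of 0] in \<open>simp_all add: blocks_diag_mult\<close>)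
qed

lemma max_heavy_incl_identity:
  assumes k: "heavy_family c k"
  shows "identity c (max_heavy_incl c k)"
proof -
  have k0: "k 0 \<in> carrier (irr_heavy (max_heavy c ! 0))" using k[rule_format, of 0] by (cases c) simp_all
  note adj0 = irr_heavy_adj[OF k0] row_finite_adj[OF irr_heavy_finite[OF k0]]
  show ?thesis
  proof (cases c)
    case (U_inf_inf F)
    then have "k 1 \<in> carrier (irr_heavy F)" using k[rule_format, of 1] by simp
    from irr_heavy_adj[OF this] row_finite_adj[OF irr_heavy_finite[OF this]] show ?thesis
      using adj0 U_inf_inf by (simp add: hermitian_form_preserved)
  next
    case (U_fin_inf F p)
    then show ?thesis using adj0 by (simp add: hermitian_form_preserved)
  next
    case Sp_R
    then show ?thesis
      using k0 symplectic_rep.symplectic_form_preserved[OF symplectic_rep_real] by simp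
  next
    case Sp_C
    then show ?thesis
      using k0 symplectic_rep.symplectic_form_preserved[OF symplectic_rep_complex] by simp
  next
    case O_C
    have "q = quat_cnj q" if "q \<in> scalar_set RR" for q
      using that by (simp add: quat_cnj_def quat.expand)
    then have "transp (k 0) = adj (k 0)"
      using finite_matrices_entry[OF irr_heavy_finite[OF k0]] O_C
      by (intro ext) (simp add: transp_def adj_def)
    then show ?thesis
      using adj0 O_C by (simp add: transp_blocks blocks_diag_mult blocks_one)
  next
    case SO_star
    then show ?thesis using k0 skew_hermitian_form_preserved by simp
  qed simp
qed

lemma max_heavy_incl_finite:
  assumes k: "heavy_family c k"
  shows "max_heavy_incl c k \<in> carrier (finite_matrices (basis c) (ground c))"
proof -
  have "\<exists>S. finite S \<and> supported_on S (k r)" if "r < length (max_heavy c)" for r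
    using k that by (meson finite_matrices_support irr_heavy_finite)
  then obtain S where S: "\<And>r. r < length (max_heavy c) \<Longrightarrow> finite (S r) \<and> supported_on (S r) (k r)"
    by metis
  define T where "T = (\<Union>r<length (max_heavy c). S r)"
  have "supported_on T (k r)" if "r < length (max_heavy c)" for r
    using S[OF that] that by (auto simp: T_def intro: supported_on_mono)
  then have "supported_on (basis c \<inter> (Inl ` T \<union> Inr ` T)) (max_heavy_incl c k)"
    by (rule max_heavy_incl_support)
  moreover have "finite (basis c \<inter> (Inl ` T \<union> Inr ` T))"
    using S by (simp add: T_def)
  ultimately show ?thesis
    using max_heavy_incl_entry[OF k] unfolding carrier_finite_matrices by blast
qed

text \<open>Invertibility follows from multiplicativity, applied to the inverses of the components.\<close>

lemma max_heavy_incl_closed: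
  assumes k: "heavy_family c k"
  shows "max_heavy_incl c k \<in> carrier (irr_classical_group c)"
proof -
  define k' where "k' r = inv\<^bsub>irr_heavy (max_heavy c ! r)\<^esub> k r" for r
  have k': "heavy_family c k'"
    using k by (simp add: k'_def group.inv_closed[OF group_irr_heavy])
  have "mat_mult (k r) (k' r) = mat_one \<and> mat_mult (k' r) (k r) = mat_one"
    if "r < length (max_heavy c)" for r
    using k that group.r_inv[OF group_irr_heavy, of "k r" "max_heavy c ! r"]
      group.l_inv[OF group_irr_heavy, of "k r" "max_heavy c ! r"]
    by (simp add: k'_def irr_heavy_simps)
  then have "max_heavy_incl c (\<lambda>r. mat_mult (k r) (k' r)) = mat_one"
    "max_heavy_incl c (\<lambda>r. mat_mult (k' r) (k r)) = mat_one"
    by (simp_all cong: max_heavy_incl_cong add: max_heavy_incl_one)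
  then have "mat_mult (max_heavy_incl c k) (max_heavy_incl c k') = mat_one"
    "mat_mult (max_heavy_incl c k') (max_heavy_incl c k) = mat_one"
    by (simp_all add: max_heavy_incl_mult k k')
  then have "max_heavy_incl c k \<in> Units (finite_matrices (basis c) (ground c))"
    using max_heavy_incl_finite[OF k] max_heavy_incl_finite[OF k'] by (auto simp: Units_def)
  then show ?thesis
    using max_heavy_incl_identity[OF k] by (simp add: irr_classical_group_def matrix_group_simps)
qed

lemma irr_classical_group_mult: "A \<otimes>\<^bsub>irr_classical_group c\<^esub> B = mat_mult A B"
  by (simp add: irr_classical_group_def matrix_group_simps)

lemma group_classical_group: "group (classical_group Gs)"
  unfolding classical_group_def by (intro product_group group_irr_classical)

text \<open>Componentwise, this is multiplicativity of the inclusions \<open>max_heavy_incl\<close>.\<close>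

lemma K_incl_hom: "K_incl Gs \<in> hom (heavy (K_index Gs) (K_factor Gs)) (classical_group Gs)"
proof (rule homI)
  have fam: "heavy_family (Gs ! i) (\<lambda>r. x (i, r))"
    if "x \<in> carrier (heavy (K_index Gs) (K_factor Gs))" "i < length Gs" for x i
    using that by (force simp: heavy_def K_index_def K_factor_def)
  show "K_incl Gs x \<in> carrier (classical_group Gs)"
    if "x \<in> carrier (heavy (K_index Gs) (K_factor Gs))" for x
    using max_heavy_incl_closed[OF fam[OF that]] by (simp add: K_incl_def classical_group_def)
  show "K_incl Gs (x \<otimes>\<^bsub>heavy (K_index Gs) (K_factor Gs)\<^esub> y) = K_incl Gs x \<otimes>\<^bsub>classical_group Gs\<^esub> K_incl Gs y"
    if x: "x \<in> carrier (heavy (K_index Gs) (K_factor Gs))"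
      and y: "y \<in> carrier (heavy (K_index Gs) (K_factor Gs))" for x y
  proof -
    have "max_heavy_incl (Gs ! i) (\<lambda>r. (x \<otimes>\<^bsub>heavy (K_index Gs) (K_factor Gs)\<^esub> y) (i, r)) =
        mat_mult (max_heavy_incl (Gs ! i) (\<lambda>r. x (i, r))) (max_heavy_incl (Gs ! i) (\<lambda>r. y (i, r)))"
      if i: "i < length Gs" for i
    proof -
      have "max_heavy_incl (Gs ! i) (\<lambda>r. (x \<otimes>\<^bsub>heavy (K_index Gs) (K_factor Gs)\<^esub> y) (i, r)) =
          max_heavy_incl (Gs ! i) (\<lambda>r. mat_mult (x (i, r)) (y (i, r)))"
        by (rule max_heavy_incl_cong) (use i in \<open>simp add: heavy_def K_index_def irr_heavy_simps\<close>)
      then show ?thesis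
        by (simp add: max_heavy_incl_mult[OF fam[OF x i] fam[OF y i]])
    qed
    then show ?thesis
      by (auto simp: K_incl_def classical_group_def irr_classical_group_mult)
  qed
qed

section \<open>Straight homomorphisms\<close>

lemma trivial_hom_unit:
  assumes "trivial_hom F F' d \<rho>" "s < d" "t < d"
  shows "\<rho> 0 s t = 0" "\<rho> 1 s t = (if s = t then 1 else 0)"
proof -
  have four: "s = 0 \<or> s = 1 \<or> s = 2 \<or> s = 3" if "s < 4" for s :: nat using that by auto
  have real: "real_rep 0 s t = 0" "real_rep 1 s t = (if s = t then 1 else 0)"
    if "s < 4" "t < 4" for s t
    using four[OF that(1)] four[OF that(2)]
    by (auto simp: real_rep_def quat_unit_def quat_defs)
  have complex: "complex_rep 0 s t = 0" "complex_rep 1 s t = (if s = t then 1 else 0)"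
    if "s < 2" "t < 2" for s t
    using that by (auto simp: complex_rep_def Let_def quat_defs quat_cnj_def less_2_cases_iff)
  show "\<rho> 0 s t = 0" "\<rho> 1 s t = (if s = t then 1 else 0)"
    using assms real complex by (cases; simp)+
qed

text \<open>By injectivity of the numbering of the basis, the finite set \<open>T\<close> meets only finitely many of the
  vectors \<open>\<phi> j n s\<close>; choose \<open>N\<close> larger than all \<open>n\<close> that occur. For \<open>x\<close> in \<open>L\<^sup>N\<close> the entries of
  \<open>x\<close> with such an index are those of the identity, and the block representations respect 0
  and 1.\<close>

lemma straight_irr_fixes:
  assumes f: "straight_irr Ls F f" and T: "finite T"
  shows "\<exists>N. \<forall>x\<in>L_stab Ls (\<lambda>_. N). supported_on (- T) (f x)"
proof -
  obtain M m d \<rho> \<phi> where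
    triv: "\<forall>j<M::nat. m j < length Ls \<and> trivial_hom (Ls ! m j) F (d j) (\<rho> j)" and
    inj: "inj_on (\<lambda>(j, n, s). \<phi> j n s :: nat) (SIGMA j : {..<M}. (UNIV :: nat set) \<times> {..<d j})" and
    all: "\<forall>g \<in> carrier (heavy_list Ls).
        (\<forall>j<M. \<forall>n n'. \<forall>s<d j. \<forall>s'<d j.
            f g (\<phi> j n s) (\<phi> j n' s') = \<rho> j (g (m j) n n') s s') \<and>
        (\<forall>a b. (\<nexists>j n n' s s'. j < M \<and> s < d j \<and> s' < d j \<and> a = \<phi> j n s \<and> b = \<phi> j n' s') \<longrightarrow>
            f g a b = mat_one a b)"
    using f unfolding straight_irr_def by (elim conjE exE) (rule that)
  have diag: "f g (\<phi> j n s) (\<phi> j n' s') = \<rho> j (g (m j) n n') s s'"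
    if "g \<in> carrier (heavy_list Ls)" "j < M" "s < d j" "s' < d j" for g j n n' s s'
    using all that by blast
  have off: "f g a b = mat_one a b"
    if g: "g \<in> carrier (heavy_list Ls)"
      and "\<nexists>j n n' s s'. j < M \<and> s < d j \<and> s' < d j \<and> a = \<phi> j n s \<and> b = \<phi> j n' s'" for g a b
    by (rule bspec[OF all g, THEN conjunct2, THEN spec, THEN spec, THEN mp, OF that(2)])
  let ?X = "(\<lambda>(j, n, s). \<phi> j n s) -` T \<inter> (SIGMA j : {..<M}. (UNIV :: nat set) \<times> {..<d j})"
  have "finite ?X" using T inj by (rule finite_vimage_IntI)
  then have "finite ((\<lambda>(j, n, s). n) ` ?X)" by (rule finite_imageI)
  then obtain N where N: "\<forall>n\<in>(\<lambda>(j, n, s). n) ` ?X. n < N"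
    unfolding finite_nat_set_iff_bounded by (rule exE)
  have small: "n < N" if "\<phi> j n s \<in> T" "j < M" "s < d j" for j n s
    by (rule bspec[OF N], rule image_eqI[of _ _ "(j, n, s)"]) (simp_all add: that)
  have "f x a b = mat_one a b" if x: "x \<in> L_stab Ls (\<lambda>_. N)" and ab: "a \<in> T \<or> b \<in> T" for x a b
  proof (cases "\<exists>j n n' s s'. j < M \<and> s < d j \<and> s' < d j \<and> a = \<phi> j n s \<and> b = \<phi> j n' s'")
    case False
    then show ?thesis using x by (intro off) (auto simp: L_stab_def)
  next
    case True
    then obtain j n n' s s' where j: "j < M" "s < d j" "s' < d j" "a = \<phi> j n s" "b = \<phi> j n' s'"
      by blast
    have "n < N \<or> n' < N" using ab j small by auto
    then have unit: "x (m j) n n' = mat_one n n'"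
      using L_stab_supported[OF x] triv[rule_format, OF j(1)] by (intro supported_onD[of "{N..}"]) auto
    have "f x a b = \<rho> j (x (m j) n n') s s'"
      using x j by (simp add: diag L_stab_def)
    also have "\<dots> = (if n = n' \<and> s = s' then 1 else 0)"
      using trivial_hom_unit[OF triv[rule_format, OF j(1), THEN conjunct2] j(2,3)]
      unfolding unit mat_one_def by (cases "n = n'"; cases "s = s'") simp_all
    also have "\<dots> = mat_one a b"
      using inj_onD[OF inj, of "(j, n, s)" "(j, n', s')"] j by (auto simp: mat_one_def)
    finally show ?thesis .
  qed
  then show ?thesis unfolding supported_on_def by blast
qed

text \<open>Let \<open>T i\<close> consist of the indices occurring in the support of the component \<open>g i\<close>. Since \<open>f\<close> is
  straight, the components of \<open>f x\<close> are trivial on \<open>T i\<close> for \<open>x\<close> far out; hence the image of \<open>x\<close> in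
  \<open>G\<close> and \<open>g\<close> have disjoint supports.\<close>

lemma classical_group_commutes_far:
  assumes f: "straight Ls (K_index Gs) (K_factor Gs) f" and g: "g \<in> carrier (classical_group Gs)"
  shows "\<exists>N. \<forall>x\<in>L_stab Ls (\<lambda>_. N).
    K_incl Gs (f x) \<otimes>\<^bsub>classical_group Gs\<^esub> g = g \<otimes>\<^bsub>classical_group Gs\<^esub> K_incl Gs (f x)"
proof -
  have gi: "g i \<in> carrier (finite_matrices (basis (Gs ! i)) (ground (Gs ! i)))" if "i < length Gs" for i
    using g that by (force simp: classical_group_def irr_classical_group_def matrix_group_simps Units_def)
  have "\<exists>S. finite S \<and> supported_on S (g i)" if "i < length Gs" for i
    using finite_matrices_support[OF gi[OF that]] by metis
  then obtain S where S: "\<And>i. i < length Gs \<Longrightarrow> finite (S i) \<and> supported_on (S i) (g i)" by metis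
  define T where "T i = Inl -` S i \<union> Inr -` S i" for i
  have finite_T: "finite (T i)" if "i < length Gs" for i
    using S[OF that] unfolding T_def by (intro finite_UnI finite_vimageI) auto
  have "\<exists>N. \<forall>x\<in>L_stab Ls (\<lambda>_. N). supported_on (- T (fst q)) (f x q)" if "q \<in> K_index Gs" for q
    by (rule straight_irr_fixes[of _ "K_factor Gs q"])
      (use f that finite_T in \<open>auto simp: straight_def K_index_def\<close>)
  then obtain N where N: "\<And>q x. q \<in> K_index Gs \<Longrightarrow> x \<in> L_stab Ls (\<lambda>_. N q) \<Longrightarrow>
      supported_on (- T (fst q)) (f x q)" by metis
  show ?thesis
  proof (intro exI[of _ "sum N (K_index Gs)"] ballI)
    fix x assume x: "x \<in> L_stab Ls (\<lambda>_. sum N (K_index Gs))"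
    have "finite (K_index Gs)" by (simp add: K_index_def)
    then have fixes_T: "supported_on (- T (fst q)) (f x q)" if "q \<in> K_index Gs" for q
      using that x L_stab_antimono[of Ls "\<lambda>_. N q" "\<lambda>_. sum N (K_index Gs)"]
      by (intro N) (auto intro: member_le_sum)
    have fxK: "f x \<in> carrier (heavy (K_index Gs) (K_factor Gs))"
      using f x by (auto simp: straight_def L_stab_def dest: hom_in_carrier)
    have "mat_mult (K_incl Gs (f x) i) (g i) = mat_mult (g i) (K_incl Gs (f x) i)"
      if i: "i < length Gs" for i
    proof -
      have eq: "K_incl Gs (f x) i = max_heavy_incl (Gs ! i) (\<lambda>r. f x (i, r))"
        using i by (simp add: K_incl_def)
      have "supported_on (basis (Gs ! i) \<inter> (Inl ` (- T i) \<union> Inr ` (- T i))) (K_incl Gs (f x) i)"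
        unfolding eq
        by (rule max_heavy_incl_support) (use fixes_T[of "(i, r)" for r] i in \<open>auto simp: K_index_def\<close>)
      then have "supported_on (- S i) (K_incl Gs (f x) i)"
        by (rule supported_on_mono) (auto simp: T_def)
      moreover have "heavy_family (Gs ! i) (\<lambda>r. f x (i, r))"
        using fxK i by (force simp: heavy_def K_index_def K_factor_def)
      then have "row_finite (K_incl Gs (f x) i)"
        unfolding eq by (rule finite_matrices_row_finite[OF max_heavy_incl_finite])
      ultimately show ?thesis
        using supported_on_commute[of "S i" "g i"] S[OF i] finite_matrices_row_finite[OF gi[OF i]]
        by simp
    qed
    then show "K_incl Gs (f x) \<otimes>\<^bsub>classical_group Gs\<^esub> g = g \<otimes>\<^bsub>classical_group Gs\<^esub> K_incl Gs (f x)"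
      by (auto simp: classical_group_def irr_classical_group_mult)
  qed
qed

section \<open>The product of double cosets of a \<open>(G,L)\<close>-pair\<close>

lemma GL_pair_theta_pair:
  assumes "GL_pair Gs Ls f"
  shows "theta_pair (heavy_list Ls) (classical_group Gs) (\<lambda>x. K_incl Gs (f x))
    (length Ls) (L_stab Ls) (Theta Ls)"
proof -
  have f: "straight Ls (K_index Gs) (K_factor Gs) f" using assms by (simp add: GL_pair_def)
  then have "f \<in> hom (heavy_list Ls) (heavy (K_index Gs) (K_factor Gs))"
    by (simp add: straight_def)
  then have hom: "(\<lambda>x. K_incl Gs (f x)) \<in> hom (heavy_list Ls) (classical_group Gs)"
    using K_incl_hom by (rule Group.hom_compose[unfolded comp_def])
  have group_hom: "group_hom (heavy_list Ls) (classical_group Gs) (\<lambda>x. K_incl Gs (f x))"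
    using hom group_heavy_list group_classical_group
    by (simp add: group_hom_def group_hom_axioms_def)
  show ?thesis
  proof (intro theta_pair.intro theta_pair_axioms.intro group_hom)
    show "subgroup (L_stab Ls \<alpha>) (heavy_list Ls)" for \<alpha>
      by (rule subgroup_L_stab)
    show "L_stab Ls \<alpha> \<subseteq> L_stab Ls \<beta>" if "\<And>j. j < length Ls \<Longrightarrow> \<beta> j \<le> \<alpha> j" for \<alpha> \<beta>
      using that by (rule L_stab_antimono)
    show "Theta Ls \<beta> m \<in> carrier (heavy_list Ls)" for \<beta> m
      by (rule Theta_closed)
  qed (use classical_group_commutes_far[OF f] Theta_push Theta_relocate in blast)+
qed

theorem proposition2p1:
  fixes Gs :: "irr_classical list" and Ls :: "scalars list" and f :: embedding
  assumes "GL_pair Gs Ls f"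
  shows
    "(\<forall>\<alpha> \<beta> \<gamma>. \<forall>A \<in> cosets_L Gs Ls f \<gamma> \<beta>. \<forall>B \<in> cosets_L Gs Ls f \<beta> \<alpha>. \<forall>g\<in>A. \<forall>h\<in>B.
        \<exists>Z. stabilizes_at (length Ls) (coset_z Gs Ls f \<gamma> \<beta> \<alpha> g h) Z)
     \<and>
     (\<forall>\<alpha> \<beta> \<gamma>. \<forall>A \<in> cosets_L Gs Ls f \<gamma> \<beta>. \<forall>B \<in> cosets_L Gs Ls f \<beta> \<alpha>.
        coset_comp Gs Ls f \<gamma> \<beta> \<alpha> A B \<in> cosets_L Gs Ls f \<gamma> \<alpha> \<and>
        (\<forall>g\<in>A. \<forall>h\<in>B. stabilizes_at (length Ls) (coset_z Gs Ls f \<gamma> \<beta> \<alpha> g h)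
           (coset_comp Gs Ls f \<gamma> \<beta> \<alpha> A B)))
     \<and>
     (\<forall>\<alpha> \<beta> \<gamma> \<delta>. \<forall>A \<in> cosets_L Gs Ls f \<delta> \<gamma>. \<forall>B \<in> cosets_L Gs Ls f \<gamma> \<beta>.
        \<forall>C \<in> cosets_L Gs Ls f \<beta> \<alpha>.
          coset_comp Gs Ls f \<delta> \<beta> \<alpha> (coset_comp Gs Ls f \<delta> \<gamma> \<beta> A B) C =
          coset_comp Gs Ls f \<delta> \<gamma> \<alpha> A (coset_comp Gs Ls f \<gamma> \<beta> \<alpha> B C))"
proof -
  interpret P: theta_pair "heavy_list Ls" "classical_group Gs" "\<lambda>x. K_incl Gs (f x)"
    "length Ls" "L_stab Ls" "Theta Ls"
    using assms by (rule GL_pair_theta_pair)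
  let ?G = "classical_group Gs"
  have stab: "subgroup_L Gs Ls f = P.stabG"
    by (intro ext) (simp add: subgroup_L_def P.stabG_def)
  have z: "coset_z Gs Ls f = P.zcoset"
    by (intro ext) (simp add: coset_z_def stab P.zcoset_def P.dcoset_def)
  have circ: "coset_comp Gs Ls f = P.circ"
    by (intro ext) (simp add: coset_comp_def z P.circ_def)
  have coset: "A \<in> cosets_L Gs Ls f \<gamma> \<alpha> \<longleftrightarrow> (\<exists>g\<in>carrier ?G. A = P.dcoset \<gamma> g \<alpha>)" for A \<gamma> \<alpha>
    by (auto simp: cosets_L_def double_cosets_def stab P.dcoset_def)
  have limit: "P.circ \<gamma> \<beta> \<alpha> A B \<in> cosets_L Gs Ls f \<gamma> \<alpha> \<and>
      (\<forall>g\<in>A. \<forall>h\<in>B. stabilizes_at (length Ls) (P.zcoset \<gamma> \<beta> \<alpha> g h) (P.circ \<gamma> \<beta> \<alpha> A B))"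
    if A: "A \<in> cosets_L Gs Ls f \<gamma> \<beta>" and B: "B \<in> cosets_L Gs Ls f \<beta> \<alpha>" for \<alpha> \<beta> \<gamma> A B
  proof -
    obtain g where g: "g \<in> carrier ?G" "A = P.dcoset \<gamma> g \<beta>" using A by (auto simp: coset)
    obtain h where h: "h \<in> carrier ?G" "B = P.dcoset \<beta> h \<alpha>" using B by (auto simp: coset)
    let ?z = "\<lambda>m. g \<otimes>\<^bsub>?G\<^esub> K_incl Gs (f (Theta Ls \<beta> m)) \<otimes>\<^bsub>?G\<^esub> h"
    obtain N where "\<forall>m. (\<forall>j<length Ls. N \<le> m j) \<longrightarrow> P.circ \<gamma> \<beta> \<alpha> A B = P.dcoset \<gamma> (?z m) \<alpha>"
      using P.circ_limit(1)[OF g(1) h(1), of \<gamma> \<beta> \<alpha>] unfolding g(2) h(2) by (rule exE)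
    then have "P.circ \<gamma> \<beta> \<alpha> A B = P.dcoset \<gamma> (?z (\<lambda>_. N)) \<alpha>" by simp
    moreover have "?z (\<lambda>_. N) \<in> carrier ?G"
      using g(1) h(1) by (intro P.H.m_closed P.i_Th_closed)
    ultimately show ?thesis
      using P.circ_limit(2)[OF g(1) h(1)] unfolding coset g(2) h(2) by blast
  qed
  have assoc: "P.circ \<delta> \<beta> \<alpha> (P.circ \<delta> \<gamma> \<beta> A B) C = P.circ \<delta> \<gamma> \<alpha> A (P.circ \<gamma> \<beta> \<alpha> B C)"
    if "A \<in> cosets_L Gs Ls f \<delta> \<gamma>" "B \<in> cosets_L Gs Ls f \<gamma> \<beta>" "C \<in> cosets_L Gs Ls f \<beta> \<alpha>"
    for \<alpha> \<beta> \<gamma> \<delta> A B C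
    using that unfolding coset by (elim bexE, hypsubst, intro P.circ_assoc)
  show ?thesis
    unfolding z circ
  proof (intro conjI allI ballI)
    fix \<alpha> \<beta> \<gamma> A B g h
    assume "A \<in> cosets_L Gs Ls f \<gamma> \<beta>" "B \<in> cosets_L Gs Ls f \<beta> \<alpha>" and gh: "g \<in> A" "h \<in> B"
    from limit[OF this(1,2)] gh
    show "stabilizes_at (length Ls) (P.zcoset \<gamma> \<beta> \<alpha> g h) (P.circ \<gamma> \<beta> \<alpha> A B)" by simp
    then show "\<exists>Z. stabilizes_at (length Ls) (P.zcoset \<gamma> \<beta> \<alpha> g h) Z" by (rule exI)
  qed (use limit assoc in simp_all)
qed

end
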